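(* There exist absolute constants $c>0$ and $R_0$ such that for every integer $R\ge R_0$ the following holds. Let $I$ be any instance of Max 2CSP-$R$, and let $\mathrm{OPT}(I)$ be the maximum, over all assignments, of the number of constraints of $I$ that are satisfied. Run the rounding algorithm described in the context on an optimal solution of the semidefinite program of the associated normalized instance $I'$, producing a random assignment $(Z_1,\dots,Z_n)$. Then the expected number of constraints of $I$ satisfied by $(Z_1,\dots,Z_n)$ is at least $c\cdot\frac{\log R}{R}\cdot \mathrm{OPT}(I)$. (That is, the algorithm achieves an $\Omega\left(\frac{\log R}{R}\right)$ approximation ratio.)
   Context: Max 2CSP-$R$: an instance consists of variables $X_1,\dots,X_n$ each ranging over a set $\Sigma$ with $|\Sigma|=R$, and a finite collection of constraints, each a predicate $f(X_i,X_j)$ on two distinct variables; the goal is an assignment maximizing the number of satisfied constraints. Normalization: each constraint $f(X_i,X_j)$ with satisfying pairs $(a_1,b_1),\dots,(a_s,b_s)$ is replaced by the $s$ constraints $(X_i=a_1)\wedge(X_j=b_1),\dots,(X_i=a_s)\wedge(X_j=b_s)$; call the resulting instance $I'$ (every assignment satisfies the same number of constraints of $I$ and of $I'$). Semidefinite program for $I'$: vectors $x_{i,a}\in\mathbb{R}^d$ for each variable index $i$ and each $a\in\Sigma$, maximizing $\sum_{C=(X_i=a)\wedge(X_j=b)\in I'}\langle x_{i,a},x_{j,b}\rangle$ subject to $\sum_{a\in\Sigma}\|x_{i,a}\|^2=1$ for all $i$; $\langle x_{i,a},x_{i,b}\rangle=0$ for all $i$ and all $a\neq b$; $\langle x_{i,a},x_{j,b}\rangle\ge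 0$ for all $i,j,a,b$. Rounding algorithm: let $p(t)=\Pr[N>t]$ for $N$ a standard normal random variable. For each $i,a$ set $p_{i,a}=\frac12\left(\frac{\|x_{i,a}\|}{\sqrt R}+\frac1R\right)$ and let $t_{i,a}$ be the real number with $p(t_{i,a})=p_{i,a}$. Choose a random vector $g\in\mathbb{R}^d$ with independent standard normal coordinates, and for each $i$ let $L_i=\{a\in\Sigma: x_{i,a}\neq 0 \text{ and } \langle x_{i,a},g\rangle\ge \|x_{i,a}\|\,t_{i,a}\}$. Then, independently for each $i$, let $Z_i$ be a uniformly random element of $L_i$ (no value is assigned to $X_i$ if $L_i$ is empty). *)

theory Defs
  imports "HOL-Probability.Probability" "HOL-Library.Multiset"
begin

text \<open>
  All bounds in the statement are absolute, so variables, alphabet symbols and coordinates are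
  natural numbers: a type-indexed alphabet or dimension would let the constants depend on the type.
  Constraints form a multiset, so that a constraint may occur several times.
\<close>

record csp2 =
  num_vars :: nat
  alphabet :: "nat set"
  constrs :: "(nat \<times> nat \<times> (nat \<Rightarrow> nat \<Rightarrow> bool)) multiset"

definition max_2csp :: "nat \<Rightarrow> csp2 \<Rightarrow> bool" where
  "max_2csp R I \<longleftrightarrow> finite (alphabet I) \<and> card (alphabet I) = R \<and>
     (\<forall>(i, j, f) \<in># constrs I. i < num_vars I \<and> j < num_vars I \<and> i \<noteq> j)"

text \<open>\<open>None\<close> stands for an unassigned variable; constraints containing one are not satisfied.\<close>

definition num_sat :: "csp2 \<Rightarrow> (nat \<Rightarrow> nat option) \<Rightarrow> nat" where
  "num_sat I Z = size {#(i, j, f) \<in># constrs I. \<exists>a b. Z i = Some a \<and> Z j = Some b \<and> f a b#}"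

definition OPT :: "csp2 \<Rightarrow> nat" where
  "OPT I = Max ((\<lambda>\<sigma>. num_sat I (Some \<circ> \<sigma>)) ` ({..<num_vars I} \<rightarrow>\<^sub>E alphabet I))"

text \<open>The tuple \<open>(i, a, j, b)\<close> encodes the constraint \<open>(X\<^sub>i = a) \<and> (X\<^sub>j = b)\<close>.\<close>

definition normalized :: "csp2 \<Rightarrow> (nat \<times> nat \<times> nat \<times> nat) multiset" where
  "normalized I = (\<Sum>(i, j, f) \<in># constrs I.
     image_mset (\<lambda>(a, b). (i, a, j, b))
       (mset_set {(a, b). a \<in> alphabet I \<and> b \<in> alphabet I \<and> f a b}))"

text \<open>
  A vector of dimension \<open>d\<close> is a function of which only the coordinates below \<open>d\<close> matter;
  its Euclidean norm is \<open>L2_set v {..<d}\<close>.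
\<close>

definition dot :: "nat \<Rightarrow> (nat \<Rightarrow> real) \<Rightarrow> (nat \<Rightarrow> real) \<Rightarrow> real" where
  "dot d u v = (\<Sum>k<d. u k * v k)"

definition sdp_feasible :: "csp2 \<Rightarrow> nat \<Rightarrow> (nat \<Rightarrow> nat \<Rightarrow> nat \<Rightarrow> real) \<Rightarrow> bool" where
  "sdp_feasible I d x \<longleftrightarrow>
     (\<forall>i<num_vars I. (\<Sum>a\<in>alphabet I. (L2_set (x i a) {..<d})\<^sup>2) = 1) \<and>
     (\<forall>i<num_vars I. \<forall>a\<in>alphabet I. \<forall>b\<in>alphabet I. a \<noteq> b \<longrightarrow> dot d (x i a) (x i b) = 0) \<and>
     (\<forall>i<num_vars I. \<forall>j<num_vars I. \<forall>a\<in>alphabet I. \<forall>b\<in>alphabet I. dot d (x i a) (x j b) \<ge> 0)"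

definition sdp_value :: "csp2 \<Rightarrow> nat \<Rightarrow> (nat \<Rightarrow> nat \<Rightarrow> nat \<Rightarrow> real) \<Rightarrow> real" where
  "sdp_value I d x = (\<Sum>(i, a, j, b) \<in># normalized I. dot d (x i a) (x j b))"

definition sdp_optimal :: "csp2 \<Rightarrow> nat \<Rightarrow> (nat \<Rightarrow> nat \<Rightarrow> nat \<Rightarrow> real) \<Rightarrow> bool" where
  "sdp_optimal I d x \<longleftrightarrow>
     sdp_feasible I d x \<and> (\<forall>y. sdp_feasible I d y \<longrightarrow> sdp_value I d y \<le> sdp_value I d x)"

abbreviation std_normal :: "real measure" where
  "std_normal \<equiv> density lborel std_normal_density"

definition gaussian_tail :: "real \<Rightarrow> real" where
  "gaussian_tail t = measure std_normal {t<..}"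

definition p_round :: "csp2 \<Rightarrow> nat \<Rightarrow> (nat \<Rightarrow> nat \<Rightarrow> nat \<Rightarrow> real) \<Rightarrow> nat \<Rightarrow> nat \<Rightarrow> real" where
  "p_round I d x i a =
     (let R = real (card (alphabet I)) in 1 / 2 * (L2_set (x i a) {..<d} / sqrt R + 1 / R))"

definition t_round :: "csp2 \<Rightarrow> nat \<Rightarrow> (nat \<Rightarrow> nat \<Rightarrow> nat \<Rightarrow> real) \<Rightarrow> nat \<Rightarrow> nat \<Rightarrow> real" where
  "t_round I d x i a = (THE t. gaussian_tail t = p_round I d x i a)"

definition L_round ::
  "csp2 \<Rightarrow> nat \<Rightarrow> (nat \<Rightarrow> nat \<Rightarrow> nat \<Rightarrow> real) \<Rightarrow> (nat \<Rightarrow> real) \<Rightarrow> nat \<Rightarrow> nat set" where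
  "L_round I d x g i = {a \<in> alphabet I. (\<exists>k<d. x i a k \<noteq> 0) \<and>
     dot d (x i a) g \<ge> L2_set (x i a) {..<d} * t_round I d x i a}"

definition choose_from :: "nat set \<Rightarrow> nat option pmf" where
  "choose_from L = (if L = {} then return_pmf None else map_pmf Some (pmf_of_set L))"

text \<open>
  The law of \<open>(Z\<^sub>i)\<^sub>i\<close>: draw the Gaussian vector \<open>g\<close>, then, given \<open>g\<close>, the values \<open>Z\<^sub>i\<close> independently
  (with \<open>Z\<^sub>i = None\<close> for indices that are not variables of the instance).
\<close>

definition rounding :: "csp2 \<Rightarrow> nat \<Rightarrow> (nat \<Rightarrow> nat \<Rightarrow> nat \<Rightarrow> real) \<Rightarrow> (nat \<Rightarrow> nat option) measure" where
  "rounding I d x =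
     (\<Pi>\<^sub>M k\<in>{..<d}. std_normal) \<bind>
       (\<lambda>g. measure_pmf (Pi_pmf {..<num_vars I} None (\<lambda>i. choose_from (L_round I d x g i))))"

lemma measurable_L_round:
  assumes "finite (alphabet I)"
  shows "(\<lambda>g. L_round I d x g i) \<in> measurable (\<Pi>\<^sub>M k\<in>{..<d}. std_normal) (count_space (Pow (alphabet I)))"
    (is "_ \<in> measurable ?G _")
proof (rule measurable_count_space_eq2[THEN iffD2], use assms in simp, safe)
  fix g a assume "a \<in> L_round I d x g i" then show "a \<in> alphabet I" by (simp add: L_round_def)
next
  fix S assume S: "S \<subseteq> alphabet I"
  have dm: "(\<lambda>g. dot d v g) \<in> borel_measurable ?G" for v
    unfolding dot_def by measurable
  have "(\<lambda>g. L_round I d x g i) -` {S} \<inter> space ?G =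
    {g \<in> space ?G. \<forall>a\<in>alphabet I. a \<in> S \<longleftrightarrow> (\<exists>k<d. x i a k \<noteq> 0) \<and>
     dot d (x i a) g \<ge> L2_set (x i a) {..<d} * t_round I d x i a}"
    using S by (auto simp: L_round_def)
  also have "\<dots> \<in> sets ?G"
  proof (rule sets.sets_Collect_finite_All[OF _ assms])
    fix a
    note [measurable] = dm
    show "{g \<in> space ?G. a \<in> S \<longleftrightarrow> (\<exists>k<d. x i a k \<noteq> 0) \<and>
     dot d (x i a) g \<ge> L2_set (x i a) {..<d} * t_round I d x i a} \<in> sets ?G"
      by (cases "a \<in> S"; cases "\<exists>k<d. x i a k \<noteq> 0") simp_all
  qed
  finally show "(\<lambda>g. L_round I d x g i) -` {S} \<inter> space ?G \<in> sets ?G" .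
qed

lemma measurable_rounding_kernel:
  assumes "finite (alphabet I)"
  shows "(\<lambda>g. measure_pmf (Pi_pmf {..<num_vars I} None (\<lambda>i. choose_from (L_round I d x g i))))
    \<in> measurable (\<Pi>\<^sub>M k\<in>{..<d}. std_normal) (subprob_algebra (count_space UNIV))"
    (is "_ \<in> measurable ?G _")
proof -
  let ?n = "num_vars I"
  let ?P = "PiE {..<?n} (\<lambda>_. Pow (alphabet I))"
  let ?F = "\<lambda>g. restrict (L_round I d x g) {..<?n}"
  have fin: "finite ?P" using assms by (intro finite_PiE) auto
  have F: "?F \<in> measurable ?G (count_space ?P)"
  proof (rule measurable_count_space_eq2[THEN iffD2, OF fin], intro conjI ballI)
    show "?F \<in> space ?G \<rightarrow> ?P" by (auto simp: L_round_def)
    fix h assume h: "h \<in> ?P"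
    have "?F -` {h} \<inter> space ?G = {g \<in> space ?G. \<forall>i\<in>{..<?n}. L_round I d x g i \<in> {h i}}"
      using h by (auto simp: fun_eq_iff PiE_def extensional_def) 
    also have "\<dots> \<in> sets ?G"
  proof (rule sets.sets_Collect_finite_All)
      fix i assume i: "i \<in> {..<?n}"
      have "(\<lambda>g. L_round I d x g i) -` {h i} \<inter> space ?G \<in> sets ?G"
        using h i by (intro measurable_sets[OF measurable_L_round[OF assms]]) auto
      also have "(\<lambda>g. L_round I d x g i) -` {h i} \<inter> space ?G =
          {g \<in> space ?G. L_round I d x g i \<in> {h i}}" by auto
      finally show "{g \<in> space ?G. L_round I d x g i \<in> {h i}} \<in> sets ?G" .
    qed simp
    finally show "?F -` {h} \<inter> space ?G \<in> sets ?G" .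
  qed
  have eq: "Pi_pmf {..<?n} None (\<lambda>i. choose_from (L_round I d x g i))
     = Pi_pmf {..<?n} None (\<lambda>i. choose_from (?F g i))" for g
    by (rule Pi_pmf_cong) auto
  have "(\<lambda>h. measure_pmf (Pi_pmf {..<?n} None (\<lambda>i. choose_from (h i))))
     \<in> measurable (count_space ?P) (subprob_algebra (count_space UNIV))"
    by (simp add: space_subprob_algebra measure_pmf.subprob_space_axioms)
  from measurable_compose[OF F this] show ?thesis
    unfolding eq .
qed

lemma prob_space_rounding:
  assumes "finite (alphabet I)"
  shows "prob_space (rounding I d x)"
proof -
  interpret prob_space std_normal by (rule prob_space_normal_density) simp
  interpret product_prob_space "\<lambda>_. std_normal" "{..<d}" ..
  show ?thesis unfolding rounding_def
    by (rule P.prob_space_bind[OF _ measurable_rounding_kernel[OF assms]])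
       (simp add: measure_pmf.prob_space_axioms)
qed

lemma size_filter_mset_sum_mset:
  "size (filter_mset P (\<Sum>x\<in>#M. F x)) = (\<Sum>x\<in>#M. size (filter_mset P (F x)))"
  by (induction M) auto

lemma num_sat_normalized:
  assumes "finite (alphabet I)" "\<forall>i a. Z i = Some a \<longrightarrow> a \<in> alphabet I"
  shows "size {#(i, a, j, b) \<in># normalized I. Z i = Some a \<and> Z j = Some b#} = num_sat I Z"
proof -
  have *: "size {#(i, a, j, b) \<in># image_mset (\<lambda>(a, b). (i, a, j, b))
       (mset_set {(a, b). a \<in> alphabet I \<and> b \<in> alphabet I \<and> f a b}). Z i = Some a \<and> Z j = Some b#}
      = (if \<exists>a b. Z i = Some a \<and> Z j = Some b \<and> f a b then 1 else 0)" for i j f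
  proof -
    let ?S = "{(a, b). a \<in> alphabet I \<and> b \<in> alphabet I \<and> f a b}"
    have fin: "finite ?S" by (rule finite_subset[of _ "alphabet I \<times> alphabet I"]) (use assms in auto)
    have "{(a, b) \<in> ?S. Z i = Some a \<and> Z j = Some b} =
      (if \<exists>a b. Z i = Some a \<and> Z j = Some b \<and> f a b then {(the (Z i), the (Z j))} else {})"
      using assms(2) by auto
    then show ?thesis using fin
      by (simp add: filter_mset_image_mset case_prod_beta')
  qed
  have **: "size (filter_mset P M) = (\<Sum>c\<in>#M. if P c then 1 else 0)" for P and M :: "'x multiset"
    by (induction M) auto
  show ?thesis
    unfolding normalized_def num_sat_def size_filter_mset_sum_mset
    unfolding **[of _ "constrs I"]
    by (intro arg_cong[where f=sum_mset] image_mset_cong) (simp only: * split_beta)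
qed
end

(*
  For a constraint (X_i = a) and (X_j = b) let u, v be the normalised vectors, rho >= 0 their inner
  product and s, t the two thresholds, both of order sqrt (ln R). Let E be the event that a lies in
  L_i and b in L_j. Conditioning on the coordinate with the larger threshold, Mills' inequality gives
  Pr[E] >= p s * p t * (1 + rho ln R / 8), at least ln R / (32 R) times the SDP contribution.

  Given E, the lists have bounded expected size. Let w be the normalised component of v orthogonal
  to u. A further label of L_i has a unit vector y orthogonal to u, and it is affected by E only
  through r = <y, w>. The squares of these r sum to at most 1 by Bessel. Labels with r <= 1 / ln R
  join the list with essentially their original probability; of the at most (ln R)^2 others, those
  with r <= 1 / 16 still join only with probability R^(-1/32), and there are fewer than 256 more.
  Hence dividing by the two list sizes costs only a constant factor.

  The SDP value is at least OPT since an assignment gives a feasible solution in which each vector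
  is either zero or one fixed unit vector.
*)
theory Submission
  imports Defs "HOL-Real_Asymp.Real_Asymp"
begin

section \<open>The Gaussian product measure\<close>

text \<open>All Gaussian facts rest on one device: replacing the coordinate of \<open>g\<close>
  along a unit vector by a fresh standard normal does not change the law of \<open>g\<close>.
  Applied once or twice, it makes the conditioning explicit, and independence of orthogonal
  coordinates never has to be stated.

  Two obstacles shape the list bound. Given E, the coordinate z along w is unbounded, so it is cut
  off at 4 sqrt (ln R). This costs about R^(-8) per label, negligible against Pr[E] >= 1 / (4 R^2),
  and shifts the threshold of a label by at most 4 r sqrt (ln R). For r <= 1 / ln R the product of
  shift and threshold is at most 8; for r <= 1 / 16 the shift uses at most half of the smallest
  threshold sqrt (ln R) / 2. Labels are not counted by class: each is charged its own tail plus 256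
  r^2, and both charges sum to constants.

  The two list sizes depend on each other, so their means cannot simply be multiplied. A linear
  minorant of 1 / (x y) needs only each conditional mean separately.

  Degenerate directions cause no case split later, because normalising the zero vector yields the
  zero vector.\<close>

interpretation lborel_PiM: product_sigma_finite "\<lambda>_::nat. lborel :: real measure" ..

abbreviation leb :: "nat \<Rightarrow> (nat \<Rightarrow> real) measure" where
  "leb d \<equiv> \<Pi>\<^sub>M k\<in>{..<d}. lborel"

abbreviation gauss :: "nat \<Rightarrow> (nat \<Rightarrow> real) measure" where
  "gauss d \<equiv> \<Pi>\<^sub>M k\<in>{..<d}. std_normal"

lemma sets_gauss: "sets (gauss d) = sets (leb d)"
  by (rule sets_PiM_cong) auto

lemma measurable_gauss_iff: "measurable (gauss d) N = measurable (leb d) N"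
  by (rule measurable_cong_sets[OF sets_gauss refl])

lemma space_leb: "space (leb d) = PiE {..<d} (\<lambda>_. UNIV)"
  by (simp add: space_PiM)

lemma measurable_dot [measurable]: "dot d u \<in> borel_measurable (leb d)"
proof -
  have "(\<lambda>g. dot d u g) \<in> borel_measurable (leb d)"
    unfolding dot_def by measurable
  then show ?thesis by simp
qed

lemma measurable_dot_gauss [measurable]: "dot d u \<in> borel_measurable (gauss d)"
  by (simp add: measurable_gauss_iff)

section \<open>Translation invariance of Lebesgue measure\<close>

lemma nn_integral_translate: 
  fixes f :: "real \<Rightarrow> ennreal"
  assumes "f \<in> borel_measurable borel"
  shows "(\<integral>\<^sup>+x. f (x + c) \<partial>lborel) = (\<integral>\<^sup>+x. f x \<partial>lborel)"
  using nn_integral_real_affine[OF assms, of 1 c] by (simp add: add.commute)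

text \<open>Boxes determine a product measure, and on a box the claim is the one-dimensional one in
  each coordinate. The \<open>restrict\<close> keeps the shifted function in the extensional space
  underlying \<open>leb d\<close>.\<close>

lemma nn_integral_leb_translate:
  assumes f: "f \<in> borel_measurable (leb d)"
  shows "(\<integral>\<^sup>+g. f (\<lambda>k\<in>{..<d}. g k + c k) \<partial>leb d) = (\<integral>\<^sup>+g. f g \<partial>leb d)"
proof -
  let ?T = "\<lambda>g. \<lambda>k\<in>{..<d}. g k + c k :: real"
  have T: "?T \<in> measurable (leb d) (leb d)" by measurable
  have "distr (leb d) (leb d) ?T = leb d"
  proof (rule lborel_PiM.PiM_eqI)
    fix A :: "nat \<Rightarrow> real set" assume A: "\<And>i. i \<in> {..<d} \<Longrightarrow> A i \<in> sets lborel"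
    have vim: "(\<lambda>x. x + c i) -` A i \<in> sets borel" if "i < d" for i
      using measurable_sets[of "\<lambda>x. x + c i" borel borel "A i"] A[of i] that by simp
    have "emeasure (distr (leb d) (leb d) ?T) (Pi\<^sub>E {..<d} A)
       = emeasure (leb d) (?T -` Pi\<^sub>E {..<d} A \<inter> space (leb d))"
      using A by (intro emeasure_distr T sets_PiM_I_finite) auto
    also have "?T -` Pi\<^sub>E {..<d} A \<inter> space (leb d) = (\<Pi>\<^sub>E i\<in>{..<d}. (\<lambda>x. x + c i) -` A i)"
      by (auto simp: space_leb PiE_iff extensional_def)
    also have "emeasure (leb d) \<dots> = (\<Prod>i<d. emeasure lborel ((\<lambda>x. x + c i) -` A i))"
      using vim by (subst lborel_PiM.emeasure_PiM) auto
    also have "\<dots> = (\<Prod>i<d. emeasure lborel (A i))"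
    proof (rule prod.cong)
      fix i assume i: "i \<in> {..<d}"
      have "emeasure lborel ((\<lambda>x. x + c i) -` A i) = (\<integral>\<^sup>+x. indicator (A i) (x + c i) \<partial>lborel)"
        using vim[of i] i by (subst nn_integral_indicator[symmetric])
          (auto simp: indicator_def simp del: nn_integral_indicator intro!: nn_integral_cong)
      also have "\<dots> = emeasure lborel (A i)"
        using A[OF i] by (subst nn_integral_translate) auto
      finally show "emeasure lborel ((\<lambda>x. x + c i) -` A i) = emeasure lborel (A i)" .
    qed simp
    finally show "emeasure (distr (leb d) (leb d) ?T) (Pi\<^sub>E {..<d} A) = (\<Prod>i<d. emeasure lborel (A i))" .
  qed auto
  then show ?thesis
    using nn_integral_distr[OF T, of f] by (simp add: f)
qed

lemma prob_space_std_normal: "prob_space std_normal"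
  by (rule prob_space_normal_density) simp

text \<open>The shears used below preserve Lebesgue measure but not the Gaussian one, so the
  Gaussian law has to appear as a weight on \<open>leb d\<close>. Agreement is checked on
  boxes.\<close>

lemma gauss_density: "gauss d = density (leb d) (\<lambda>g. \<Prod>k<d. ennreal (std_normal_density (g k)))"
proof -
  interpret N: prob_space std_normal by (rule prob_space_std_normal)
  interpret N: product_prob_space "\<lambda>_::nat. std_normal" ..
  have "density (leb d) (\<lambda>g. \<Prod>k<d. ennreal (std_normal_density (g k))) = gauss d"
  proof (rule N.PiM_eqI)
    show "sets (density (leb d) (\<lambda>g. \<Prod>k<d. ennreal (std_normal_density (g k)))) = sets (gauss d)"
      by (simp add: sets_gauss)
    fix A :: "nat \<Rightarrow> real set" assume "\<And>i. i \<in> {..<d} \<Longrightarrow> A i \<in> sets std_normal"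
    then have A: "\<And>i. i < d \<Longrightarrow> A i \<in> sets borel" by simp
    have "emeasure (density (leb d) (\<lambda>g. \<Prod>k<d. ennreal (std_normal_density (g k)))) (Pi\<^sub>E {..<d} A)
       = (\<integral>\<^sup>+g. (\<Prod>k<d. ennreal (std_normal_density (g k))) * indicator (Pi\<^sub>E {..<d} A) g \<partial>leb d)"
      using A by (intro emeasure_density sets_PiM_I_finite) auto
    also have "\<dots> = (\<integral>\<^sup>+g. (\<Prod>k<d. ennreal (std_normal_density (g k)) * indicator (A k) (g k)) \<partial>leb d)"
      by (rule nn_integral_cong)
        (auto simp: prod.distrib space_leb indicator_def PiE_iff prod_zero_iff)
    also have "\<dots> = (\<Prod>k<d. \<integral>\<^sup>+x. ennreal (std_normal_density x) * indicator (A k) x \<partial>lborel)"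
      using A by (subst lborel_PiM.product_nn_integral_prod) auto
    also have "\<dots> = (\<Prod>k<d. emeasure std_normal (A k))"
      using A by (intro prod.cong) (auto simp: emeasure_density)
    finally show "emeasure (density (leb d) (\<lambda>g. \<Prod>k<d. ennreal (std_normal_density (g k)))) (Pi\<^sub>E {..<d} A)
       = (\<Prod>k<d. emeasure std_normal (A k))" .
  qed auto
  then show ?thesis by simp
qed

lemma prod_std_normal_density:
  "(\<Prod>k<d. ennreal (std_normal_density (g k))) = ennreal ((1 / sqrt (2 * pi)) ^ d * exp (- dot d g g / 2))"
proof -
  have "(\<Prod>k<d. std_normal_density (g k)) = (1 / sqrt (2 * pi)) ^ d * exp (- dot d g g / 2)"
    unfolding std_normal_density_def prod.distrib dot_def
    by (simp add: exp_sum[symmetric] sum_negf sum_divide_distrib power2_eq_square)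
  then show ?thesis by (subst prod_ennreal) auto
qed

section \<open>Bilinearity of the inner product\<close>

lemma dot_commute: "dot d u v = dot d v u"
  by (simp add: dot_def mult.commute)

lemma dot_restrict [simp]: "dot d u (restrict v {..<d}) = dot d u v" "dot d (restrict u {..<d}) v = dot d u v"
  by (simp_all add: dot_def)

lemma dot_add_right [simp]: "dot d u (\<lambda>k. v k + w k) = dot d u v + dot d u w"
  and dot_add_left [simp]: "dot d (\<lambda>k. v k + w k) u = dot d v u + dot d w u"
  by (simp_all add: dot_def algebra_simps sum.distrib)

lemma dot_diff_right [simp]: "dot d u (\<lambda>k. v k - w k) = dot d u v - dot d u w"
  and dot_diff_left [simp]: "dot d (\<lambda>k. v k - w k) u = dot d v u - dot d w u"
  by (simp_all add: dot_def algebra_simps sum_subtractf)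

lemma dot_cmult_right [simp]: "dot d u (\<lambda>k. c * v k) = c * dot d u v"
  and dot_cmult_left [simp]: "dot d (\<lambda>k. c * v k) u = c * dot d v u"
  by (simp_all add: dot_def sum_distrib_left algebra_simps)

lemma dot_div_right [simp]: "dot d u (\<lambda>k. v k / c) = dot d u v / c"
  and dot_div_left [simp]: "dot d (\<lambda>k. v k / c) u = dot d v u / c"
  by (simp_all add: dot_def sum_divide_distrib)

lemma dot_self: "dot d u u = (L2_set u {..<d})\<^sup>2"
  by (simp add: dot_def L2_set_def sum_nonneg power2_eq_square)

lemma sigma_finite_leb: "sigma_finite_measure (leb d)"
  by (rule lborel_PiM.sigma_finite) simp

lemma nn_integral_leb_swap:
  fixes f :: "real \<Rightarrow> (nat \<Rightarrow> real) \<Rightarrow> ennreal"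
  assumes "(\<lambda>(x, g). f x g) \<in> borel_measurable (borel \<Otimes>\<^sub>M leb d)"
  shows "(\<integral>\<^sup>+x. \<integral>\<^sup>+g. f x g \<partial>leb d \<partial>lborel) = (\<integral>\<^sup>+g. \<integral>\<^sup>+x. f x g \<partial>lborel \<partial>leb d)"
proof -
  interpret P: pair_sigma_finite "lborel :: real measure" "leb d"
    by (intro pair_sigma_finite.intro sigma_finite_leb) unfold_locales
  have "(\<lambda>(x, g). f x g) \<in> borel_measurable (lborel \<Otimes>\<^sub>M leb d)"
    using assms by (simp cong: measurable_cong_sets sets_pair_measure_cong)
  from P.Fubini'[OF this] show ?thesis by simp
qed


text \<open>
  The swap of \<open>x\<close> with the coordinate of \<open>g\<close> along the unit vector \<open>u\<close> is, up to a sign, a composition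
  of three shears, so it preserves the Lebesgue measure.
\<close>

lemma nn_integral_leb_rotate:
  fixes V :: "real \<Rightarrow> (nat \<Rightarrow> real) \<Rightarrow> ennreal"
  assumes V: "(\<lambda>(x, g). V x g) \<in> borel_measurable (borel \<Otimes>\<^sub>M leb d)" and u: "dot d u u = 1"
  shows "(\<integral>\<^sup>+x. \<integral>\<^sup>+g. V (dot d u g) (\<lambda>k\<in>{..<d}. g k + (x - dot d u g) * u k) \<partial>leb d \<partial>lborel)
       = (\<integral>\<^sup>+x. \<integral>\<^sup>+g. V x g \<partial>leb d \<partial>lborel)"
proof -
  have V': "(\<lambda>y. V (a y) (b y)) \<in> borel_measurable M"
    if "a \<in> borel_measurable M" "b \<in> measurable M (leb d)" for a b and M :: "'a measure"
  proof -
    have "(\<lambda>y. (a y, b y)) \<in> measurable M (borel \<Otimes>\<^sub>M leb d)" using that by measurable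
    from measurable_compose[OF this V] show ?thesis by simp
  qed
  note [measurable] = V'
  let ?s = "\<lambda>g x. \<lambda>k\<in>{..<d}. g k + x * u k"
  have "(\<integral>\<^sup>+x. \<integral>\<^sup>+g. V (dot d u g) (?s g (x - dot d u g)) \<partial>leb d \<partial>lborel)
      = (\<integral>\<^sup>+g. \<integral>\<^sup>+x. V (dot d u g) (?s g (x - dot d u g)) \<partial>lborel \<partial>leb d)"
    by (rule nn_integral_leb_swap) measurable
  also have "\<dots> = (\<integral>\<^sup>+g. \<integral>\<^sup>+x. V (dot d u g) (?s g x) \<partial>lborel \<partial>leb d)"
  proof (rule nn_integral_cong)
    fix g assume g: "g \<in> space (leb d)"
    then have *: "(\<lambda>x. g) \<in> measurable borel (leb d)" by simp
    then have "(\<lambda>x. \<lambda>k\<in>{..<d}. g k + x * u k) \<in> measurable borel (leb d)" by measurable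
    then have "(\<lambda>x. V (dot d u g) (?s g x)) \<in> borel_measurable borel" by measurable
    from nn_integral_translate[OF this, of "- dot d u g"]
    show "(\<integral>\<^sup>+x. V (dot d u g) (?s g (x - dot d u g)) \<partial>lborel) = (\<integral>\<^sup>+x. V (dot d u g) (?s g x) \<partial>lborel)"
      by simp
  qed
  also have "\<dots> = (\<integral>\<^sup>+x. \<integral>\<^sup>+g. V (dot d u g) (?s g x) \<partial>leb d \<partial>lborel)"
    by (rule nn_integral_leb_swap[symmetric]) measurable
  also have "\<dots> = (\<integral>\<^sup>+x. \<integral>\<^sup>+g. V (dot d u g - x) g \<partial>leb d \<partial>lborel)"
  proof (rule nn_integral_cong)
    fix x :: real
    have "(\<lambda>g. V (dot d u g - x) g) \<in> borel_measurable (leb d)" by measurable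
    from nn_integral_leb_translate[OF this, of "\<lambda>k. x * u k"]
    show "(\<integral>\<^sup>+g. V (dot d u g) (?s g x) \<partial>leb d) = (\<integral>\<^sup>+g. V (dot d u g - x) g \<partial>leb d)"
      by (simp add: u)
  qed
  also have "\<dots> = (\<integral>\<^sup>+g. \<integral>\<^sup>+x. V (dot d u g - x) g \<partial>lborel \<partial>leb d)"
    by (rule nn_integral_leb_swap) measurable
  also have "\<dots> = (\<integral>\<^sup>+g. \<integral>\<^sup>+x. V x g \<partial>lborel \<partial>leb d)"
  proof (rule nn_integral_cong)
    fix g assume g: "g \<in> space (leb d)"
    then have [measurable]: "(\<lambda>x. g) \<in> measurable borel (leb d)" by simp
    have "(\<lambda>x. V x g) \<in> borel_measurable borel" by measurable
    from nn_integral_real_affine[OF this, of "-1" "dot d u g"]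
    show "(\<integral>\<^sup>+x. V (dot d u g - x) g \<partial>lborel) = (\<integral>\<^sup>+x. V x g \<partial>lborel)"
      by simp
  qed
  also have "\<dots> = (\<integral>\<^sup>+x. \<integral>\<^sup>+g. V x g \<partial>leb d \<partial>lborel)"
    by (rule nn_integral_leb_swap[symmetric]) measurable
  finally show ?thesis .
qed

section \<open>Resampling one coordinate of a Gaussian vector\<close>

lemma nn_integral_gauss:
  assumes "F \<in> borel_measurable (leb d)"
  shows "(\<integral>\<^sup>+g. F g \<partial>gauss d)
    = (\<integral>\<^sup>+g. ennreal ((1 / sqrt (2 * pi)) ^ d * exp (- dot d g g / 2)) * F g \<partial>leb d)"
  unfolding gauss_density prod_std_normal_density[symmetric]
  using assms by (subst nn_integral_density) auto

lemma measurable_dot_self [measurable]: "(\<lambda>g. dot d g g) \<in> borel_measurable (leb d)"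
  unfolding dot_def by measurable

text \<open>The pair of a fresh normal \<open>x\<close> and the vector \<open>g\<close> has a
  density depending only on \<open>x\<close> squared plus the squared norm of \<open>g\<close>.
  Swapping \<open>x\<close> with the coordinate of \<open>g\<close> along \<open>u\<close> preserves
  this quantity as well as Lebesgue measure. Hence the modified vector is again standard Gaussian,
  its coordinate along \<open>u\<close> is exactly \<open>x\<close>, and the rest comes from
  \<open>g\<close>. This takes the place of rotation invariance.\<close>

lemma nn_integral_gauss_resample_unit:
  assumes F: "F \<in> borel_measurable (leb d)" and u: "dot d u u = 1"
  shows "(\<integral>\<^sup>+x. \<integral>\<^sup>+g. F (\<lambda>k\<in>{..<d}. g k + (x - dot d u g) * u k) \<partial>gauss d \<partial>std_normal)
       = (\<integral>\<^sup>+g. F g \<partial>gauss d)"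
proof -
  define W where "W x g = ennreal ((1 / sqrt (2 * pi)) ^ Suc d * exp (- (x\<^sup>2 + dot d g g) / 2))" for x g
  have W: "ennreal (std_normal_density x) * (ennreal ((1 / sqrt (2 * pi)) ^ d * exp (- dot d g g / 2)) * y) = W x g * y"
    for x g y
  proof -
    have "std_normal_density x * ((1 / sqrt (2 * pi)) ^ d * exp (- dot d g g / 2))
      = (1 / sqrt (2 * pi)) ^ Suc d * exp (- (x\<^sup>2 + dot d g g) / 2)"
      by (simp add: std_normal_density_def exp_add[symmetric] add_divide_distrib mult.left_commute)
    then have "W x g = ennreal (std_normal_density x) * ennreal ((1 / sqrt (2 * pi)) ^ d * exp (- dot d g g / 2))"
      unfolding W_def by (subst ennreal_mult[symmetric]) auto
    then show ?thesis by (simp add: mult.assoc)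
  qed
  have [measurable]: "(\<lambda>y. W (a y) (b y)) \<in> borel_measurable M"
    if "a \<in> borel_measurable M" "b \<in> measurable M (leb d)" for a b and M :: "'a measure"
    unfolding W_def using that by measurable
  note [measurable] = F
  have *: "(\<integral>\<^sup>+x. \<integral>\<^sup>+g. H x g \<partial>gauss d \<partial>std_normal) = (\<integral>\<^sup>+x. \<integral>\<^sup>+g. W x g * H x g \<partial>leb d \<partial>lborel)"
    if H: "(\<lambda>(x, g). H x g) \<in> borel_measurable (borel \<Otimes>\<^sub>M leb d)" for H
  proof -
    interpret L: sigma_finite_measure "leb d" by (rule sigma_finite_leb)
    have H1: "(\<lambda>g. H x g) \<in> borel_measurable (leb d)" for x
      using measurable_compose[OF measurable_Pair1' H, of x] by simp
    have m: "(\<lambda>x. \<integral>\<^sup>+g. ennreal ((1 / sqrt (2 * pi)) ^ d * exp (- dot d g g / 2)) * H x g \<partial>leb d) \<in> borel_measurable borel"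
      using H by measurable
    have "(\<integral>\<^sup>+x. \<integral>\<^sup>+g. H x g \<partial>gauss d \<partial>std_normal)
      = (\<integral>\<^sup>+x. \<integral>\<^sup>+g. ennreal ((1 / sqrt (2 * pi)) ^ d * exp (- dot d g g / 2)) * H x g \<partial>leb d \<partial>std_normal)"
      by (simp add: nn_integral_gauss H1)
    also have "\<dots> = (\<integral>\<^sup>+x. ennreal (std_normal_density x) *
        (\<integral>\<^sup>+g. ennreal ((1 / sqrt (2 * pi)) ^ d * exp (- dot d g g / 2)) * H x g \<partial>leb d) \<partial>lborel)"
      using m by (intro nn_integral_density) auto
    also have "\<dots> = (\<integral>\<^sup>+x. \<integral>\<^sup>+g. W x g * H x g \<partial>leb d \<partial>lborel)"
      unfolding W[symmetric]
      by (intro nn_integral_cong nn_integral_cmult[symmetric] borel_measurable_times_ennreal H1) measurable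
    finally show ?thesis .
  qed
  let ?s = "\<lambda>g x. \<lambda>k\<in>{..<d}. g k + x * u k"
  \<comment> \<open>The orthogonal part of \<open>g\<close> is untouched, and the squares of
    \<open>x\<close> and \<open>dot d u g\<close> merely change places in the exponent.\<close>
  have W_inv: "W (dot d u g) (?s g (x - dot d u g)) = W x g" for x g
    unfolding W_def
    by (simp add: u dot_commute[of d g u]) (simp add: algebra_simps power2_eq_square)
  interpret N: prob_space std_normal by (rule prob_space_std_normal)
  have "(\<integral>\<^sup>+x. \<integral>\<^sup>+g. F (?s g (x - dot d u g)) \<partial>gauss d \<partial>std_normal)
      = (\<integral>\<^sup>+x. \<integral>\<^sup>+g. W x g * F (?s g (x - dot d u g)) \<partial>leb d \<partial>lborel)"
    by (rule *) measurable
  also have "\<dots> = (\<integral>\<^sup>+x. \<integral>\<^sup>+g. W (dot d u g) (?s g (x - dot d u g)) * F (?s g (x - dot d u g)) \<partial>leb d \<partial>lborel)"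
    unfolding W_inv ..
  also have "\<dots> = (\<integral>\<^sup>+x. \<integral>\<^sup>+g. W x g * F g \<partial>leb d \<partial>lborel)"
    by (rule nn_integral_leb_rotate[where V="\<lambda>x g. W x g * F g", OF _ u]) measurable
  also have "\<dots> = (\<integral>\<^sup>+x. \<integral>\<^sup>+g. F g \<partial>gauss d \<partial>std_normal)"
    by (rule *[symmetric]) measurable
  also have "\<dots> = (\<integral>\<^sup>+g. F g \<partial>gauss d)"
    using N.emeasure_space_1 by (simp)
  finally show ?thesis .
qed

section \<open>Half-spaces and quadrants\<close>

definition unit_vec :: "nat \<Rightarrow> (nat \<Rightarrow> real) \<Rightarrow> nat \<Rightarrow> real" where
  "unit_vec d v = (\<lambda>k. v k / L2_set v {..<d})"

lemma dot_unit_left: "dot d (unit_vec d v) g = dot d v g / L2_set v {..<d}"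
  by (simp add: unit_vec_def)

lemma dot_unit_right: "dot d g (unit_vec d v) = dot d g v / L2_set v {..<d}"
  by (simp add: unit_vec_def)

lemma dot_unit_unit: "dot d (unit_vec d v) (unit_vec d v) = (if L2_set v {..<d} = 0 then 0 else 1)"
  unfolding dot_unit_left dot_unit_right by (simp add: dot_self power2_eq_square)

lemma unit_vec_idem:
  assumes "dot d u u = 1"
  shows "unit_vec d u = u"
proof -
  have "L2_set u {..<d} = 1"
    using assms L2_set_nonneg[of u "{..<d}"] by (auto simp: dot_self power2_eq_1_iff)
  then show ?thesis by (simp add: unit_vec_def)
qed

text \<open>For \<open>v\<close> = 0 division by zero makes \<open>unit_vec d v\<close> the zero
  vector, so the substitution leaves \<open>g\<close> fixed. This lets the residual of one vector
  against another be resampled even if it vanishes.\<close>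

lemma nn_integral_gauss_resample:
  assumes F: "F \<in> borel_measurable (leb d)"
  shows "(\<integral>\<^sup>+x. \<integral>\<^sup>+g. F (\<lambda>k\<in>{..<d}. g k + (x - dot d (unit_vec d v) g) * unit_vec d v k) \<partial>gauss d \<partial>std_normal)
       = (\<integral>\<^sup>+g. F g \<partial>gauss d)"
proof (cases "L2_set v {..<d} = 0")
  case True
  interpret N: prob_space std_normal by (rule prob_space_std_normal)
  have "(\<integral>\<^sup>+g. F (\<lambda>k\<in>{..<d}. g k + (x - dot d (unit_vec d v) g) * unit_vec d v k) \<partial>gauss d) = (\<integral>\<^sup>+g. F g \<partial>gauss d)" for x
    by (intro nn_integral_cong arg_cong[of _ _ F])
      (auto simp: True unit_vec_def fun_eq_iff space_PiM PiE_iff extensional_def)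
  then show ?thesis using N.emeasure_space_1 by simp
next
  case False
  then show ?thesis by (intro nn_integral_gauss_resample_unit F) (simp add: dot_unit_unit)
qed

interpretation N: prob_space std_normal by (rule prob_space_std_normal)

lemma prob_space_gauss: "prob_space (gauss d)"
proof -
  interpret product_prob_space "\<lambda>_::nat. std_normal" "{..<d}" ..
  show ?thesis by (rule P.prob_space_axioms)
qed

interpretation gauss: prob_space "gauss d" for d by (rule prob_space_gauss)

text \<open>Resampling along \<open>v\<close> turns \<open>dot d v g\<close> into the norm of
  \<open>v\<close> times the fresh normal, and nothing else of \<open>g\<close> is left in the
  integrand.\<close>

lemma nn_integral_gauss_dot:
  assumes [measurable]: "f \<in> borel_measurable borel"
  shows "(\<integral>\<^sup>+g. f (dot d v g) \<partial>gauss d) = (\<integral>\<^sup>+x. f (L2_set v {..<d} * x) \<partial>std_normal)"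
proof -
  have *: "dot d v g + (x - dot d (unit_vec d v) g) * dot d v (unit_vec d v) = L2_set v {..<d} * x" for x g
  proof -
    have "L2_set v {..<d} = 0 \<Longrightarrow> dot d v g = 0" by (simp add: L2_set_eq_0_iff dot_def)
    then show ?thesis by (simp add: dot_unit_left dot_unit_right dot_self power2_eq_square field_simps)
  qed
  have "(\<integral>\<^sup>+g. f (dot d v g) \<partial>gauss d) = (\<integral>\<^sup>+x. \<integral>\<^sup>+g. f (L2_set v {..<d} * x) \<partial>gauss d \<partial>std_normal)"
    by (subst nn_integral_gauss_resample[symmetric, of _ _ v]) (simp_all add: *)
  also have "\<dots> = (\<integral>\<^sup>+x. f (L2_set v {..<d} * x) \<partial>std_normal)"
    by (simp add: gauss.emeasure_space_1)
  finally show ?thesis .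
qed

lemma emeasure_std_normal_singleton: "emeasure std_normal {x} = 0"
  by (subst emeasure_density) (auto intro!: nn_integral_0_iff_AE[THEN iffD2] AE_I[of _ _ "{x}"] split: split_indicator)

text \<open>The tail function uses the open ray while the lists are cut out by closed half-spaces;
  the normal law has no atoms.\<close>

lemma measure_std_normal_atLeast: "measure std_normal {t..} = gaussian_tail t"
proof -
  have "{t..} = {t} \<union> {t<..}" by auto
  moreover have "measure std_normal ({t} \<union> {t<..}) = measure std_normal {t} + measure std_normal {t<..}"
    by (rule N.finite_measure_Union) auto
  ultimately show ?thesis
    by (simp add: gaussian_tail_def measure_def emeasure_std_normal_singleton)
qed

lemma emeasure_std_normal_atLeast: "emeasure std_normal {t..} = ennreal (gaussian_tail t)"
  by (simp add: N.emeasure_eq_measure measure_std_normal_atLeast)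

lemma gaussian_tail_nonneg: "gaussian_tail t \<ge> 0"
  by (simp add: gaussian_tail_def)

lemma gaussian_tail_antimono: "s \<le> t \<Longrightarrow> gaussian_tail t \<le> gaussian_tail s"
  unfolding gaussian_tail_def by (intro N.finite_measure_mono) auto

lemma halfspace_sets: "{g \<in> space (gauss d). dot d v g \<ge> t} \<in> sets (gauss d)"
  by measurable

lemma emeasure_halfspace:
  "emeasure (gauss d) {g \<in> space (gauss d). dot d v g \<ge> t}
    = emeasure std_normal {x. L2_set v {..<d} * x \<ge> t}"
proof -
  have "emeasure (gauss d) {g \<in> space (gauss d). dot d v g \<ge> t}
      = (\<integral>\<^sup>+g. indicator {t..} (dot d v g) \<partial>gauss d)"
    by (subst nn_integral_indicator[symmetric])
       (auto intro!: nn_integral_cong halfspace_sets split: split_indicator simp del: nn_integral_indicator)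
  also have "\<dots> = (\<integral>\<^sup>+x. indicator {t..} (L2_set v {..<d} * x) \<partial>std_normal)"
    by (rule nn_integral_gauss_dot) simp
  also have "\<dots> = (\<integral>\<^sup>+x. indicator {x. L2_set v {..<d} * x \<ge> t} x \<partial>std_normal)"
    by (intro nn_integral_cong) (simp split: split_indicator)
  also have "\<dots> = emeasure std_normal {x. L2_set v {..<d} * x \<ge> t}"
    by (rule nn_integral_indicator) simp
  finally show ?thesis .
qed

text \<open>Equality holds for \<open>v\<close> different from 0. Scaling the threshold by the norm,
  rather than dividing by it, also admits \<open>v\<close> = 0, where the half-space is
  everything.\<close>

lemma prob_halfspace_ge:
  "measure (gauss d) {g \<in> space (gauss d). dot d v g \<ge> L2_set v {..<d} * t} \<ge> gaussian_tail t"
proof -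
  have "{t..} \<subseteq> {x. L2_set v {..<d} * x \<ge> L2_set v {..<d} * t}"
    by (auto intro: mult_left_mono)
  then have "emeasure std_normal {t..} \<le> emeasure (gauss d) {g \<in> space (gauss d). dot d v g \<ge> L2_set v {..<d} * t}"
    unfolding emeasure_halfspace by (intro emeasure_mono) auto
  then show ?thesis
    by (simp add: emeasure_std_normal_atLeast gauss.emeasure_eq_measure gaussian_tail_nonneg)
qed

text \<open>Only an upper bound on the norm is needed: for a positive threshold, shrinking the
  vector makes the event rarer. It is applied to a projected unit vector.\<close>

lemma prob_halfspace_le:
  assumes "t > 0" "L2_set v {..<d} \<le> 1"
  shows "measure (gauss d) {g \<in> space (gauss d). dot d v g \<ge> t} \<le> gaussian_tail t"
proof -
  have "x \<ge> t" if "L2_set v {..<d} * x \<ge> t" for x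
  proof -
    have "x > 0" using that assms(1) L2_set_nonneg[of v "{..<d}"]
      by (smt (verit) mult_nonneg_nonpos)
    then have "L2_set v {..<d} * x \<le> 1 * x" by (intro mult_right_mono assms) simp
    then show ?thesis using that by linarith
  qed
  then have "emeasure (gauss d) {g \<in> space (gauss d). dot d v g \<ge> t} \<le> emeasure std_normal {t..}"
    unfolding emeasure_halfspace by (intro emeasure_mono) auto
  then show ?thesis
    by (simp add: emeasure_std_normal_atLeast gauss.emeasure_eq_measure gaussian_tail_nonneg)
qed

section \<open>Joint probabilities of two and three half-spaces\<close>

lemma quadrant_sets: "{g \<in> space (gauss d). dot d u g \<ge> s \<and> dot d v g \<ge> t} \<in> sets (gauss d)"
  by measurable

text \<open>Fix the coordinate along \<open>u\<close> to a value \<open>x\<close> >=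
  \<open>s\<close>. Then \<open>dot d v g\<close> becomes \<rho> \<open>x\<close> plus an
  independent normal of variance 1 - \<rho>^2, so it suffices that the latter exceeds
  \<open>t\<close> (1 - \<rho>). Relative to its standard deviation this threshold is at most
  \<open>t\<close> (1 - \<rho>/2), which is the gain from correlation.\<close>

lemma prob_quadrant_ge:
  assumes u: "dot d u u = 1" and v: "dot d v v = 1" and \<rho>: "dot d u v \<ge> 0" and t: "0 \<le> t" "t \<le> s"
  shows "measure (gauss d) {g \<in> space (gauss d). dot d u g \<ge> s \<and> dot d v g \<ge> t}
    \<ge> gaussian_tail s * gaussian_tail (t * (1 - dot d u v / 2))"
proof -
  define \<rho> where "\<rho> = dot d u v"
  define w where "w = (\<lambda>k. v k - \<rho> * u k)"
  define \<tau> where "\<tau> = t * (1 - \<rho> / 2)"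
  define E where "E = {g \<in> space (gauss d). dot d u g \<ge> s \<and> dot d v g \<ge> t}"
  define K where "K = {g \<in> space (gauss d). dot d w g \<ge> L2_set w {..<d} * \<tau>}"
  have w2: "(L2_set w {..<d})\<^sup>2 = 1 - \<rho>\<^sup>2"
    unfolding dot_self[symmetric] w_def
    by (simp add: u v dot_commute[of d v u] \<rho>_def[symmetric] power2_eq_square)
  have "\<rho>\<^sup>2 \<le> 1\<^sup>2"
    using w2 zero_le_power2[of "L2_set w {..<d}"] unfolding power_one by linarith
  then have \<rho>1: "0 \<le> \<rho>" "\<rho> \<le> 1"
    using \<rho> power2_le_imp_le[of \<rho> 1] by (auto simp: \<rho>_def)
  \<comment> \<open>Without the factor \<open>t\<close> and after squaring this reads (1 - \<rho>)^2
    <= (1 - \<rho>^2) (1 - \<rho>/2)^2. The difference factors as \<rho> (1 - \<rho>) (4 - 3 \<rho>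
    + \<rho>^2) / 4. Avoiding division by the norm of \<open>w\<close> keeps \<rho> = 1
    included.\<close>
  have "t * (1 - \<rho>) \<le> L2_set w {..<d} * \<tau>"
  proof -
    have "(1 - \<rho>)\<^sup>2 \<le> (L2_set w {..<d} * (1 - \<rho> / 2))\<^sup>2"
    proof -
      have "0 \<le> \<rho> * (1 - \<rho>) * (4 - 3 * \<rho> + \<rho>\<^sup>2) + 0"
      proof -
        have "4 - 3 * \<rho> + \<rho>\<^sup>2 \<ge> 0" using \<rho>1 zero_le_power2[of \<rho>] by linarith
        then show ?thesis using \<rho>1 by simp
      qed
      also have "\<dots> = 4 * ((1 - \<rho>\<^sup>2) * (1 - \<rho> / 2)\<^sup>2 - (1 - \<rho>)\<^sup>2)"
        by algebra
      finally show ?thesis by (simp add: w2 power_mult_distrib)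
    qed
    then have "1 - \<rho> \<le> L2_set w {..<d} * (1 - \<rho> / 2)"
      by (rule power2_le_imp_le) (use \<rho>1 in auto)
    from mult_left_mono[OF this t(1)] show ?thesis by (simp add: \<tau>_def mult_ac)
  qed
  \<comment> \<open>Here the order \<open>t\<close> <= \<open>s\<close> matters: any
    \<open>x\<close> >= \<open>s\<close> is also at least \<open>t\<close>, so \<rho>
    \<open>x\<close> contributes at least \<rho> \<open>t\<close>.\<close>
  then have step: "t - \<rho> * x \<le> L2_set w {..<d} * \<tau>" if "x \<ge> s" for x
  proof -
    have "\<rho> * t \<le> \<rho> * x" using that t \<rho>1 by (intro mult_left_mono) auto
    then show ?thesis using \<open>t * (1 - \<rho>) \<le> _\<close> by (simp add: algebra_simps)
  qed
  have E: "E \<in> sets (gauss d)" unfolding E_def by (rule quadrant_sets)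
  then have mE: "indicator E \<in> borel_measurable (leb d)" by (simp add: sets_gauss)
  have unit: "unit_vec d u = u" using u by (rule unit_vec_idem)
  define S where "S x g = (\<lambda>k\<in>{..<d}. g k + (x - dot d u g) * u k)" for x g
  have Su: "dot d u (S x g) = x" and SS: "S x g \<in> space (gauss d)" for x g
    by (simp_all add: S_def u space_PiM)
  have Sv: "dot d v (S x g) = \<rho> * x + dot d w g" for x g
    by (simp add: S_def w_def \<rho>_def dot_commute[of d v u]) (simp add: algebra_simps)
  have "ennreal (gaussian_tail s) * emeasure (gauss d) K
      = (\<integral>\<^sup>+x. indicator {s..} x * emeasure (gauss d) K \<partial>std_normal)"
    by (subst nn_integral_multc) (auto simp: emeasure_std_normal_atLeast)
  also have "\<dots> = (\<integral>\<^sup>+x. \<integral>\<^sup>+g. indicator {s..} x * indicator K g \<partial>gauss d \<partial>std_normal)"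
    unfolding K_def by (subst nn_integral_cmult) (auto simp: halfspace_sets)
  also have "\<dots> \<le> (\<integral>\<^sup>+x. \<integral>\<^sup>+g. indicator E (S x g) \<partial>gauss d \<partial>std_normal)"
  proof (intro nn_integral_mono)
    fix x g
    show "indicator {s..} x * indicator K g \<le> (indicator E (S x g) :: ennreal)"
      using step[of x] SS unfolding E_def K_def
      by (auto simp: Su Sv split: split_indicator)
  qed
  also have "\<dots> = emeasure (gauss d) E"
    using E nn_integral_gauss_resample[OF mE, of u] by (simp add: unit S_def)
  finally have "gaussian_tail s * measure (gauss d) K \<le> measure (gauss d) E"
    by (simp add: gauss.emeasure_eq_measure gaussian_tail_nonneg ennreal_mult[symmetric])
  moreover have "measure (gauss d) K \<ge> gaussian_tail \<tau>"
    unfolding K_def by (rule prob_halfspace_ge)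
  ultimately show ?thesis
    unfolding E_def \<tau>_def \<rho>_def
    by (meson gaussian_tail_nonneg mult_left_mono order_trans)
qed

text \<open>Resample along \<open>u\<close> and along the normalised residual w of \<open>v\<close>,
  with fresh coordinates x and z. The quadrant event then depends on (x, z) only, while
  \<open>dot d y g\<close> becomes \<open>r\<close> z plus an independent normal of variance at most
  1. For z <= \<open>Z\<close> this normal must exceed \<open>t'\<close> - \<open>r\<close>
  \<open>Z\<close>; the event z > \<open>Z\<close> is paid for by the additive tail.\<close>

lemma prob_quadrant_halfspace_le:
  assumes u: "dot d u u = 1" and y: "dot d y y = 1" and orth: "dot d u y = 0"
    and r: "r = dot d y (unit_vec d (\<lambda>k. v k - dot d u v * u k))" "r \<ge> 0"
    and Z: "Z \<ge> 0" and pos: "t' - r * Z > 0"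
  shows "measure (gauss d) {g \<in> space (gauss d). (dot d u g \<ge> s \<and> dot d v g \<ge> t) \<and> dot d y g \<ge> t'}
    \<le> gaussian_tail (t' - r * Z) * measure (gauss d) {g \<in> space (gauss d). dot d u g \<ge> s \<and> dot d v g \<ge> t}
      + gaussian_tail Z"
proof -
  define \<rho> where "\<rho> = dot d u v"
  define v' where "v' = (\<lambda>k. v k - \<rho> * u k)"
  define w where "w = unit_vec d v'"
  define \<sigma> where "\<sigma> = L2_set v' {..<d}"
  define q where "q = (\<lambda>k. y k - r * w k)"
  define E where "E = {g \<in> space (gauss d). dot d u g \<ge> s \<and> dot d v g \<ge> t}"
  define D where "D = {g \<in> space (gauss d). (dot d u g \<ge> s \<and> dot d v g \<ge> t) \<and> dot d y g \<ge> t'}"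
  define K where "K = {g \<in> space (gauss d). dot d q g \<ge> t' - r * Z}"
  have E: "E \<in> sets (gauss d)" and D: "D \<in> sets (gauss d)" and K: "K \<in> sets (gauss d)"
    unfolding E_def D_def K_def by measurable
  have mE: "indicator E \<in> borel_measurable (leb d)" and mD: "indicator D \<in> borel_measurable (leb d)"
    using D E by (simp_all add: sets_gauss)
  have r_def: "r = dot d y w" using r by (simp add: w_def v'_def \<rho>_def)
  have unit: "unit_vec d u = u" using u by (rule unit_vec_idem)
  have uw: "dot d u w = 0"
    by (simp add: w_def dot_unit_right v'_def u \<rho>_def)
  have ww: "dot d w w \<le> 1" unfolding w_def dot_unit_unit by simp
  have v'w: "dot d v' w = \<sigma>"
    by (simp add: w_def dot_unit_right dot_self \<sigma>_def power2_eq_square)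
  have \<sigma>w: "\<sigma> * dot d w g = dot d v' g" for g
  proof -
    have "\<sigma> = 0 \<Longrightarrow> dot d v' g = 0" by (simp add: \<sigma>_def L2_set_eq_0_iff dot_def)
    then show ?thesis by (simp add: w_def dot_unit_left \<sigma>_def)
  qed
  let ?T = "\<lambda>e x g. \<lambda>k\<in>{..<d}. g k + (x - dot d e g) * e k"
  have gT: "?T e x g \<in> space (gauss d)" for e x g by (simp add: space_PiM)
  have T_meas: "(\<lambda>g. ?T e x g) \<in> measurable (leb d) (leb d)" for e x by measurable
  \<comment> \<open>Since \<open>u\<close> is orthogonal to \<open>w\<close>, the two replacements
    do not disturb each other.\<close>
  define S where "S x z g = ?T u x (?T w z g)" for x z g
  have yw: "dot d y u = 0" using orth by (simp add: dot_commute)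
  have two: "(\<integral>\<^sup>+g. F g \<partial>gauss d) = (\<integral>\<^sup>+x. \<integral>\<^sup>+z. \<integral>\<^sup>+g. F (S x z g) \<partial>gauss d \<partial>std_normal \<partial>std_normal)"
    if "F \<in> borel_measurable (leb d)" for F :: "_ \<Rightarrow> ennreal"
  proof -
    have "(\<integral>\<^sup>+g. F g \<partial>gauss d) = (\<integral>\<^sup>+x. \<integral>\<^sup>+g. F (?T u x g) \<partial>gauss d \<partial>std_normal)"
      using nn_integral_gauss_resample[OF that, of u] by (simp add: unit)
    also have "\<dots> = (\<integral>\<^sup>+x. \<integral>\<^sup>+z. \<integral>\<^sup>+g. F (S x z g) \<partial>gauss d \<partial>std_normal \<partial>std_normal)"
      unfolding w_def S_def
      by (intro nn_integral_cong nn_integral_gauss_resample[OF measurable_compose[OF T_meas that], symmetric])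
    finally show ?thesis .
  qed
  have du: "dot d u (?T u x g) = x" for x g
    by (simp add: u)
  have dv: "dot d v (S x z g) = \<rho> * x + \<sigma> * z" for x z g
  proof -
    have a: "dot d v h = dot d v' h + \<rho> * dot d u h" for h by (simp add: v'_def)
    have "dot d v' u = 0"
      by (simp add: v'_def u \<rho>_def dot_commute[of d v u])
    then have b: "dot d v' (?T u x h) = dot d v' h" for h by simp
    have "dot d v' (?T w z g) = dot d v' g + (z - dot d w g) * \<sigma>" by (simp add: v'w)
    also have "\<dots> = \<sigma> * z" using \<sigma>w[of g] by (simp add: algebra_simps)
    finally show ?thesis by (simp only: a[of "?T u x (?T w z g)"] du b add.commute S_def)
  qed
  have dy: "dot d y (S x z g) = r * z + dot d q g" for x z g
  proof -
    have a: "dot d y (?T u x h) = dot d y h" for h by (simp add: yw)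
    have b: "dot d q g = dot d y g - r * dot d w g" by (simp add: q_def)
    have "dot d y (?T w z g) = dot d y g + (z - dot d w g) * r" by (simp add: r_def)
    also have "\<dots> = r * z + dot d q g" unfolding b by (simp add: algebra_simps)
    finally show ?thesis by (simp only: a S_def)
  qed
  have dS: "dot d u (S x z g) = x" and gS: "S x z g \<in> space (gauss d)" for x z g
    unfolding S_def by (rule du, rule gT)
  have "emeasure (gauss d) D = (\<integral>\<^sup>+g. indicator D g \<partial>gauss d)" using D by simp
  also have "\<dots> = (\<integral>\<^sup>+x. \<integral>\<^sup>+z. \<integral>\<^sup>+g. indicator D (S x z g) \<partial>gauss d \<partial>std_normal \<partial>std_normal)"
    by (rule two[OF mD])
  also have "\<dots> \<le> (\<integral>\<^sup>+x. \<integral>\<^sup>+z. indicator {(x, z). x \<ge> s \<and> \<rho> * x + \<sigma> * z \<ge> t} (x, z) * emeasure (gauss d) K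
      + indicator {Z<..} z \<partial>std_normal \<partial>std_normal)"
  proof (intro nn_integral_mono)
    fix x z :: real
    have "(\<integral>\<^sup>+g. indicator D (S x z g) \<partial>gauss d)
      \<le> (\<integral>\<^sup>+g. indicator {(x, z). x \<ge> s \<and> \<rho> * x + \<sigma> * z \<ge> t} (x, z) * indicator K g + indicator {Z<..} z \<partial>gauss d)"
    proof (intro nn_integral_mono)
      fix g assume g: "g \<in> space (gauss d)"
      \<comment> \<open>The sign of \<open>r\<close> is what allows a one-sided cut: only large
        positive z can help \<open>y\<close>.\<close>
      have "r * z \<le> r * Z" if "z \<le> Z" using that r by (intro mult_left_mono)
      then show "indicator D (S x z g) \<le>
         (indicator {(x, z). x \<ge> s \<and> \<rho> * x + \<sigma> * z \<ge> t} (x, z) * indicator K g + indicator {Z<..} z :: ennreal)"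
        using gS g by (auto simp: D_def K_def dS dv dy split: split_indicator)
    qed
    also have "\<dots> = indicator {(x, z). x \<ge> s \<and> \<rho> * x + \<sigma> * z \<ge> t} (x, z) * emeasure (gauss d) K + indicator {Z<..} z"
      using K by (subst nn_integral_add) (auto simp: nn_integral_cmult gauss.emeasure_space_1)
    finally show "(\<integral>\<^sup>+g. indicator D (S x z g) \<partial>gauss d) \<le> \<dots>" .
  qed
  also have "\<dots> = (\<integral>\<^sup>+x. \<integral>\<^sup>+z. indicator {(x, z). x \<ge> s \<and> \<rho> * x + \<sigma> * z \<ge> t} (x, z) \<partial>std_normal \<partial>std_normal) * emeasure (gauss d) K
      + ennreal (gaussian_tail Z)"
  proof -
    have m: "(\<lambda>(x, z). indicator {(x, z). x \<ge> s \<and> \<rho> * x + \<sigma> * z \<ge> t} (x, z) :: ennreal) \<in> borel_measurable (std_normal \<Otimes>\<^sub>M std_normal)"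
      by measurable
    have m1: "(\<lambda>z. indicator {(x, z). x \<ge> s \<and> \<rho> * x + \<sigma> * z \<ge> t} (x, z) :: ennreal) \<in> borel_measurable std_normal" for x
      using measurable_compose[OF measurable_Pair1' m, of x] by simp
    have m2: "(\<lambda>x. \<integral>\<^sup>+z. indicator {(x, z). x \<ge> s \<and> \<rho> * x + \<sigma> * z \<ge> t} (x, z) \<partial>std_normal) \<in> borel_measurable std_normal"
      using N.borel_measurable_nn_integral[OF m] by simp
    have "emeasure std_normal {Z<..} = ennreal (gaussian_tail Z)"
      by (simp add: gaussian_tail_def N.emeasure_eq_measure)
    then show ?thesis
      using m1 m2 N.emeasure_space_1 by (simp add: nn_integral_add nn_integral_multc del: indicator_simps)
  qed
  also have "(\<integral>\<^sup>+x. \<integral>\<^sup>+z. indicator {(x, z). x \<ge> s \<and> \<rho> * x + \<sigma> * z \<ge> t} (x, z) \<partial>std_normal \<partial>std_normal)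
     = (\<integral>\<^sup>+x. \<integral>\<^sup>+z. \<integral>\<^sup>+g. indicator E (S x z g) \<partial>gauss d \<partial>std_normal \<partial>std_normal)"
  proof (intro nn_integral_cong)
    fix x z
    have "(\<integral>\<^sup>+g. indicator E (S x z g) \<partial>gauss d)
      = (\<integral>\<^sup>+g. indicator {(x, z). x \<ge> s \<and> \<rho> * x + \<sigma> * z \<ge> t} (x, z) \<partial>gauss d)"
      by (intro nn_integral_cong) (use gS in \<open>auto simp: E_def dS dv split: split_indicator\<close>)
    then show "indicator {(x, z). x \<ge> s \<and> \<rho> * x + \<sigma> * z \<ge> t} (x, z) = (\<integral>\<^sup>+g. indicator E (S x z g) \<partial>gauss d)"
      by (simp add: gauss.emeasure_space_1 del: indicator_simps)
  qed
  also have "\<dots> = (\<integral>\<^sup>+g. indicator E g \<partial>gauss d)"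
    by (rule two[OF mE, symmetric])
  also have "\<dots> = emeasure (gauss d) E" using E by simp
  finally have "measure (gauss d) D \<le> measure (gauss d) E * measure (gauss d) K + gaussian_tail Z"
    by (simp add: gauss.emeasure_eq_measure gaussian_tail_nonneg ennreal_mult[symmetric] ennreal_plus[symmetric] del: ennreal_plus)
  moreover have "measure (gauss d) K \<le> gaussian_tail (t' - r * Z)"
    unfolding K_def
  proof (rule prob_halfspace_le[OF pos])
    \<comment> \<open>For a unit vector \<open>w\<close> this is 1 - \<open>r\<close>^2. The bound
      \<open>ww\<close> instead of an equation also covers \<open>w\<close> = 0, where the residual
      of \<open>v\<close> vanishes.\<close>
    have "(L2_set q {..<d})\<^sup>2 = 1 - 2 * r\<^sup>2 + r\<^sup>2 * dot d w w"
      unfolding dot_self[symmetric] q_def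
      by (simp add: y r_def dot_commute[of d w y]) (simp add: power2_eq_square algebra_simps)
    also have "r\<^sup>2 * dot d w w \<le> r\<^sup>2 * 1" using ww by (intro mult_left_mono) auto
    finally have "(L2_set q {..<d})\<^sup>2 \<le> 1\<^sup>2" using zero_le_power2[of r] unfolding power_one by linarith
    then show "L2_set q {..<d} \<le> 1" by (rule power2_le_imp_le) simp
  qed
  ultimately show ?thesis
    unfolding D_def[symmetric] E_def[symmetric]
    by (smt (verit) measure_nonneg mult.commute mult_left_mono)
qed

section \<open>Gaussian tails\<close>

lemma gaussian_tail_diff:
  assumes "s \<le> t"
  shows "gaussian_tail s - gaussian_tail t = measure std_normal {s<..t}"
proof -
  have "{s<..} = {s<..t} \<union> {t<..}" using assms by auto
  moreover have "measure std_normal ({s<..t} \<union> {t<..}) = measure std_normal {s<..t} + measure std_normal {t<..}"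
    by (rule N.finite_measure_Union) auto
  ultimately show ?thesis by (simp add: gaussian_tail_def)
qed

lemma std_normal_density_antimono: "\<bar>x\<bar> \<le> y \<Longrightarrow> std_normal_density y \<le> std_normal_density x"
  by (simp add: std_normal_density_def divide_right_mono abs_le_square_iff[symmetric])

lemma gaussian_tail_diff_ge:
  assumes "s \<le> t" "\<bar>s\<bar> \<le> m" "\<bar>t\<bar> \<le> m"
  shows "(t - s) * std_normal_density m \<le> gaussian_tail s - gaussian_tail t"
proof -
  have "ennreal ((t - s) * std_normal_density m) = (\<integral>\<^sup>+x. ennreal (std_normal_density m) * indicator {s<..t} x \<partial>lborel)"
    using assms by (simp add: nn_integral_cmult ennreal_mult mult.commute)
  also have "\<dots> \<le> (\<integral>\<^sup>+x. ennreal (std_normal_density x) * indicator {s<..t} x \<partial>lborel)"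
    using assms by (intro nn_integral_mono) (auto split: split_indicator intro!: std_normal_density_antimono)
  also have "\<dots> = emeasure std_normal {s<..t}"
    by (subst emeasure_density) auto
  also have "\<dots> = ennreal (gaussian_tail s - gaussian_tail t)"
    by (simp add: gaussian_tail_diff assms N.emeasure_eq_measure)
  finally show ?thesis
    using gaussian_tail_diff[OF assms(1)] by (subst (asm) ennreal_le_iff) auto
qed

lemma gaussian_tail_diff_le:
  assumes "0 \<le> s" "s \<le> t"
  shows "gaussian_tail s - gaussian_tail t \<le> (t - s) * std_normal_density s"
proof -
  have "ennreal (gaussian_tail s - gaussian_tail t) = emeasure std_normal {s<..t}"
    by (simp add: gaussian_tail_diff assms N.emeasure_eq_measure)
  also have "\<dots> = (\<integral>\<^sup>+x. ennreal (std_normal_density x) * indicator {s<..t} x \<partial>lborel)"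
    by (subst emeasure_density) auto
  also have "\<dots> \<le> (\<integral>\<^sup>+x. ennreal (std_normal_density s) * indicator {s<..t} x \<partial>lborel)"
    using assms by (intro nn_integral_mono) (auto split: split_indicator intro!: std_normal_density_antimono)
  also have "\<dots> = ennreal ((t - s) * std_normal_density s)"
    using assms by (simp add: nn_integral_cmult ennreal_mult mult.commute)
  finally show ?thesis using assms by (subst (asm) ennreal_le_iff) auto
qed

text \<open>On the ray of integration \<open>t\<close> <= x, and x times the density has the
  negative of the density as antiderivative.\<close>

lemma gaussian_tail_mills_upper:
  assumes "t \<ge> 0"
  shows "t * gaussian_tail t \<le> std_normal_density t"
proof -
  have "ennreal (t * gaussian_tail t) = ennreal t * emeasure std_normal {t..}"
    using assms by (simp add: emeasure_std_normal_atLeast ennreal_mult gaussian_tail_nonneg)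
  also have "\<dots> = (\<integral>\<^sup>+x. ennreal t * (ennreal (std_normal_density x) * indicator {t..} x) \<partial>lborel)"
    by (simp add: emeasure_density nn_integral_cmult)
  also have "\<dots> \<le> (\<integral>\<^sup>+x. ennreal (x * std_normal_density x) * indicator {t..} x \<partial>lborel)"
    using assms by (intro nn_integral_mono)
      (auto split: split_indicator simp: ennreal_mult intro!: mult_right_mono ennreal_leI)
  also have "\<dots> = ennreal (0 - (- std_normal_density t))"
  proof (rule nn_integral_FTC_atLeast)
    show "((\<lambda>x. - std_normal_density x) has_real_derivative x * std_normal_density x) (at x)" for x
      unfolding std_normal_density_def
      by (rule derivative_eq_intros refl | simp)+
    show "((\<lambda>x. - std_normal_density x) \<longlongrightarrow> 0) at_top"
      unfolding std_normal_density_def by real_asymp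
  qed (use assms in auto)
  finally show ?thesis by (subst (asm) ennreal_le_iff) auto
qed

lemma std_normal_density_shift:
  "std_normal_density (t + \<delta>) = std_normal_density t * exp (- (t * \<delta>) - \<delta>\<^sup>2 / 2)"
  by (simp add: std_normal_density_def exp_add[symmetric] power2_sum add_divide_distrib)

text \<open>The window from \<open>t\<close> to \<open>t\<close> + 1/\<open>t\<close> alone
  suffices: on it the density drops by at most the factor exp (1 + 1/(2 \<open>t\<close>^2)), which
  is generously bounded by exp 2.\<close>

lemma gaussian_tail_mills_lower:
  assumes "t \<ge> 1"
  shows "std_normal_density t \<le> exp 2 * t * gaussian_tail t"
proof -
  have "1 / t \<le> 1" using assms by simp
  then have "(1 / t)\<^sup>2 \<le> 1\<^sup>2" using assms by (intro power_mono) auto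
  then have "(1 / t)\<^sup>2 / 2 \<le> 1" by simp
  then have "exp (- 2) \<le> exp (- (t * (1 / t)) - (1 / t)\<^sup>2 / 2)"
    using assms by simp
  then have "std_normal_density t * exp (- 2) \<le> std_normal_density (t + 1 / t)"
    unfolding std_normal_density_shift by (intro mult_left_mono) auto
  also have "\<dots> \<le> t * (gaussian_tail t - gaussian_tail (t + 1 / t))"
    using gaussian_tail_diff_ge[of t "t + 1 / t" "t + 1 / t"] assms by (simp add: field_simps)
  also have "\<dots> \<le> t * gaussian_tail t"
    using assms gaussian_tail_nonneg[of "t + 1 / t"] by (intro mult_left_mono) auto
  finally show ?thesis by (simp add: exp_minus field_simps)
qed

text \<open>Lowering the threshold adds a window of length \<rho> \<open>t\<close> / 2 on which the
  density is at least its value at \<open>t\<close>, hence at least \<open>t\<close> times the tail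
  by Mills.\<close>

lemma gaussian_tail_shrink_ge:
  assumes "0 \<le> t" "0 \<le> \<rho>" "\<rho> \<le> 1"
  shows "gaussian_tail t * (1 + \<rho> * t\<^sup>2 / 2) \<le> gaussian_tail (t * (1 - \<rho> / 2))"
proof -
  have "t * \<rho> / 2 * (t * gaussian_tail t) \<le> t * \<rho> / 2 * std_normal_density t"
    using assms by (intro mult_left_mono gaussian_tail_mills_upper) auto
  also have "\<dots> \<le> gaussian_tail (t * (1 - \<rho> / 2)) - gaussian_tail t"
  proof -
    have "0 \<le> \<rho> * t" "\<rho> * t \<le> t" using assms by (auto intro: mult_left_le_one_le)
    then have "t * (1 - \<rho> / 2) \<le> t" "\<bar>t * (1 - \<rho> / 2)\<bar> \<le> t"
      by (auto simp: algebra_simps abs_le_iff)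
    from gaussian_tail_diff_ge[OF this] assms show ?thesis by (simp add: algebra_simps)
  qed
  finally show ?thesis by (simp add: algebra_simps power2_eq_square)
qed

lemma gaussian_tail_le_exp:
  assumes "t \<ge> 1"
  shows "gaussian_tail t \<le> exp (- t\<^sup>2 / 2)"
proof -
  have "gaussian_tail t \<le> t * gaussian_tail t"
    using assms mult_right_mono[OF assms gaussian_tail_nonneg[of t]] by simp
  also have "\<dots> \<le> std_normal_density t" by (rule gaussian_tail_mills_upper) (use assms in simp)
  also have "\<dots> \<le> 1 * exp (- t\<^sup>2 / 2)"
    unfolding std_normal_density_def
    by (intro mult_right_mono) (use pi_gt3 in \<open>auto simp: real_le_rsqrt\<close>)
  finally show ?thesis by simp
qed

text \<open>The added window has length \<delta> and density at most exp \<open>B\<close> times that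
  at \<open>t\<close>; the lower Mills bound converts the density back into a tail. So a shift of
  order 1/\<open>t\<close> costs only a constant factor.\<close>

lemma gaussian_tail_shift_le:
  assumes "1 \<le> t" "0 \<le> \<delta>" "\<delta> \<le> t" "t * \<delta> \<le> B"
  shows "gaussian_tail (t - \<delta>) \<le> (1 + B * exp (B + 2)) * gaussian_tail t"
proof -
  have "\<delta> * std_normal_density (t - \<delta>) \<le> \<delta> * (std_normal_density t * exp B)"
  proof -
    have "std_normal_density (t - \<delta>) = std_normal_density t * exp (t * \<delta> - \<delta>\<^sup>2 / 2)"
      using std_normal_density_shift[of t "- \<delta>"] by simp
    also have "\<dots> \<le> std_normal_density t * exp B"
      using assms by (intro mult_left_mono) (auto intro: order_trans[rotated])
    finally show ?thesis using assms by (intro mult_left_mono)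
  qed
  also have "\<dots> \<le> \<delta> * ((exp 2 * t * gaussian_tail t) * exp B)"
    using assms by (intro mult_left_mono mult_right_mono gaussian_tail_mills_lower) auto
  also have "\<dots> = (t * \<delta>) * (exp (B + 2) * gaussian_tail t)"
    by (simp add: exp_add)
  also have "\<dots> \<le> B * (exp (B + 2) * gaussian_tail t)"
    using assms gaussian_tail_nonneg by (intro mult_right_mono) auto
  finally show ?thesis
    using gaussian_tail_diff_le[of "t - \<delta>" t] assms by (simp add: algebra_simps)
qed

section \<open>Existence and size of thresholds\<close>

lemma gaussian_tail_strict_antimono: "s < t \<Longrightarrow> gaussian_tail t < gaussian_tail s"
  using gaussian_tail_diff_ge[of s t "max \<bar>s\<bar> \<bar>t\<bar>"] normal_density_pos[of 1 0 "max \<bar>s\<bar> \<bar>t\<bar>"]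
  by (smt (verit) mult_pos_pos)

text \<open>This makes the definite description in \<open>t_round\<close> meaningful. Existence is
  the intermediate value theorem for an atomless distribution function; uniqueness is strict
  monotonicity.\<close>

lemma gaussian_tail_ex1:
  assumes "0 < p" "p < 1"
  shows "\<exists>!t. gaussian_tail t = p"
proof -
  interpret D: real_distribution std_normal
    by unfold_locales auto
  have eq: "gaussian_tail t = 1 - cdf std_normal t" for t
    using N.prob_compl[of "{..t}"] by (simp add: gaussian_tail_def cdf_def Compl_eq_Diff_UNIV[symmetric])
  have cont: "continuous_on S (cdf std_normal)" for S
    by (intro continuous_at_imp_continuous_on) (simp add: D.isCont_cdf measure_def emeasure_std_normal_singleton)
  have "eventually (\<lambda>t. cdf std_normal t > 1 - p) at_top"
    by (rule order_tendstoD[OF D.cdf_lim_at_top_prob]) (use assms in simp)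
  then obtain b where b: "b \<ge> 0" "cdf std_normal b > 1 - p"
    by (auto simp: eventually_at_top_linorder dest: spec[of _ "max 0 _"]) (metis max.cobounded1 max.cobounded2)
  have "eventually (\<lambda>t. cdf std_normal t < 1 - p) at_bot"
    by (rule order_tendstoD[OF D.cdf_lim_at_bot]) (use assms in simp)
  then obtain a where a: "a \<le> 0" "cdf std_normal a < 1 - p"
    by (auto simp: eventually_at_bot_linorder) (metis min.cobounded1 min.cobounded2)
  obtain t where "cdf std_normal t = 1 - p"
    using IVT'[of "cdf std_normal" a "1 - p" b] a b cont by auto
  then have "gaussian_tail t = p" by (simp add: eq)
  moreover have "s = t" if "gaussian_tail s = p" "gaussian_tail t = p" for s t
    using gaussian_tail_strict_antimono[of s t] gaussian_tail_strict_antimono[of t s] that by linarith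
  ultimately show ?thesis by blast
qed

text \<open>With \<open>l\<close> = ln R the hypothesis says that the tail is at least 1 / (2 R).
  Beyond 2 sqrt \<open>l\<close> it would be below R^(-2).\<close>

lemma threshold_upper:
  assumes "gaussian_tail t \<ge> exp (- l) / 2" "l \<ge> 1"
  shows "t \<le> 2 * sqrt l"
proof (rule ccontr)
  assume "\<not> t \<le> 2 * sqrt l"
  then have t: "t > 2 * sqrt l" by simp
  have "sqrt l \<ge> 1" using assms by simp
  with t have "t \<ge> 1" by linarith
  have "(2 * sqrt l)\<^sup>2 < t\<^sup>2" using t assms by (intro power_strict_mono) auto
  then have "4 * l < t\<^sup>2" using assms by (simp add: power_mult_distrib)
  then have "exp (- t\<^sup>2 / 2) < exp (- l) * exp (- l)" by (simp add: exp_add[symmetric])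
  also have "\<dots> \<le> exp (- l) * (1 / 2)"
  proof -
    have "2 \<le> exp l" using exp_ge_add_one_self[of l] assms by linarith
    then show ?thesis by (simp add: exp_minus field_simps)
  qed
  finally show False using gaussian_tail_le_exp[OF \<open>t \<ge> 1\<close>] assms by simp
qed

text \<open>With \<open>l\<close> = ln R the tail is at most R^(-1/2). By Mills the tail at sqrt
  \<open>l\<close> / 2 is of order R^(-1/8) up to a factor sqrt \<open>l\<close>, which is larger
  once \<open>l\<close> is large; the last hypothesis records just that comparison.\<close>

lemma threshold_lower:
  assumes "gaussian_tail t \<le> exp (- l / 2)" "l \<ge> 4"
    and l: "exp (- l / 2) * exp 2 * (sqrt l / 2) < std_normal_density (sqrt l / 2)"
  shows "sqrt l / 2 \<le> t"
proof (rule ccontr)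
  assume "\<not> sqrt l / 2 \<le> t"
  then have "gaussian_tail (sqrt l / 2) \<le> exp (- l / 2)"
    using gaussian_tail_antimono[of t "sqrt l / 2"] assms by simp
  moreover have "sqrt l \<ge> sqrt 4" using assms by (intro real_sqrt_le_mono)
  then have "sqrt l / 2 \<ge> 1" by simp
  ultimately have "exp 2 * (sqrt l / 2) * gaussian_tail (sqrt l / 2) \<le> exp 2 * (sqrt l / 2) * exp (- l / 2)"
    using assms(2) by (intro mult_left_mono) auto
  then show False
    using gaussian_tail_mills_lower[OF \<open>sqrt l / 2 \<ge> 1\<close>] l by (simp add: mult_ac)
qed

lemma threshold_lower_eventually:
  "eventually (\<lambda>l. exp (- l / 2) * exp 2 * (sqrt l / 2) < std_normal_density (sqrt l / 2)) at_top"
proof -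
  have "eventually (\<lambda>l::real. exp (- l / 2) * exp 2 * (sqrt l / 2) < 1 / sqrt (2 * pi) * exp (- l / 8)) at_top"
    by real_asymp
  with eventually_ge_at_top[of 0] show ?thesis
    by eventually_elim (simp add: std_normal_density_def power_divide)
qed

section \<open>Expected list sizes\<close>

lemma dot_sum_right: "dot d u (\<lambda>k. \<Sum>a\<in>A. f a k) = (\<Sum>a\<in>A. dot d u (f a))"
  and dot_sum_left: "dot d (\<lambda>k. \<Sum>a\<in>A. f a k) u = (\<Sum>a\<in>A. dot d (f a) u)"
  unfolding dot_def
  by (subst sum.swap, simp add: sum_distrib_left sum_distrib_right)+

text \<open>The residual of \<open>w\<close> after subtracting its projection onto the span of the
  family has nonnegative squared length.\<close>

lemma bessel_dot:
  assumes "finite A" and e: "\<And>a b. a \<in> A \<Longrightarrow> b \<in> A \<Longrightarrow> dot d (e a) (e b) = (if a = b then 1 else 0)"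
  shows "(\<Sum>a\<in>A. (dot d (e a) w)\<^sup>2) \<le> dot d w w"
proof -
  define r where "r a = dot d (e a) w" for a
  define q where "q = (\<lambda>k. \<Sum>a\<in>A. r a * e a k)"
  have "dot d q w = (\<Sum>a\<in>A. (r a)\<^sup>2)"
    by (simp add: q_def dot_sum_left r_def[symmetric] power2_eq_square)
  moreover have "dot d q q = (\<Sum>a\<in>A. (r a)\<^sup>2)"
  proof -
    have "dot d q q = (\<Sum>a\<in>A. r a * (\<Sum>b\<in>A. r b * dot d (e a) (e b)))"
      by (simp add: q_def dot_sum_left dot_sum_right)
    also have "\<dots> = (\<Sum>a\<in>A. r a * (\<Sum>b\<in>A. if a = b then r b else 0))"
      using e by (intro sum.cong refl arg_cong2[of _ _ _ _ "(*)"]) auto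
    also have "\<dots> = (\<Sum>a\<in>A. (r a)\<^sup>2)"
      using assms(1) by (simp add: power2_eq_square)
    finally show ?thesis .
  qed
  moreover have "0 \<le> dot d (\<lambda>k. w k - q k) (\<lambda>k. w k - q k)"
    by (simp only: dot_self zero_le_power2)
  ultimately show ?thesis by (simp add: dot_commute[of d w q] r_def)
qed

lemma dot_unit_le_1:
  assumes "dot d u u = 1" "dot d v v = 1"
  shows "dot d u v \<le> 1"
proof -
  have "(dot d u v)\<^sup>2 \<le> 1\<^sup>2"
    using bessel_dot[of "{0::nat}" d "\<lambda>_. u" v] assms by simp
  then show ?thesis by (rule power2_le_imp_le) simp
qed

text \<open>The gain comes from the smaller threshold. Replacing it by a common lower bound
  \<open>m\<close> makes the statement symmetric, so the vector with the larger threshold can be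
  conditioned on. Used with \<open>m\<close> = 0 for plain positive correlation and with
  \<open>m\<close> = sqrt l / 2 for the gain 1 + \<rho> l / 8.\<close>

lemma prob_quadrant_ge':
  assumes u: "dot d u u = 1" and v: "dot d v v = 1" and \<rho>: "dot d u v \<ge> 0"
    and m: "0 \<le> m" "m \<le> s" "m \<le> t"
  shows "measure (gauss d) {g \<in> space (gauss d). dot d u g \<ge> s \<and> dot d v g \<ge> t}
    \<ge> gaussian_tail s * gaussian_tail t * (1 + dot d u v * m\<^sup>2 / 2)"
proof -
  have *: "gaussian_tail s * gaussian_tail t * (1 + \<rho> * m\<^sup>2 / 2) \<le> gaussian_tail s * gaussian_tail (t * (1 - \<rho> / 2))"
    if "0 \<le> \<rho>" "\<rho> \<le> 1" "m \<le> t" for \<rho> s t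
  proof -
    have "m\<^sup>2 \<le> t\<^sup>2" using that m by (intro power_mono) auto
    then have "\<rho> * m\<^sup>2 / 2 \<le> \<rho> * t\<^sup>2 / 2" using that by (intro divide_right_mono mult_left_mono) auto
    then have "gaussian_tail t * (1 + \<rho> * m\<^sup>2 / 2) \<le> gaussian_tail t * (1 + \<rho> * t\<^sup>2 / 2)"
      by (intro mult_left_mono) (auto simp: gaussian_tail_nonneg)
    also have "\<dots> \<le> gaussian_tail (t * (1 - \<rho> / 2))"
      using that m by (intro gaussian_tail_shrink_ge) auto
    finally show ?thesis
      unfolding mult.assoc by (intro mult_left_mono) (auto simp: gaussian_tail_nonneg)
  qed
  have \<rho>1: "dot d u v \<le> 1" by (rule dot_unit_le_1[OF u v])
  show ?thesis
  proof (cases "t \<le> s")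
    case True
    then show ?thesis
      using order_trans[OF * prob_quadrant_ge[OF u v \<rho> _ True]] \<rho> \<rho>1 m by simp
  next
    case False
    then have "s \<le> t" by simp
    have eq: "dot d v u = dot d u v" by (rule dot_commute)
    show ?thesis
      using order_trans[OF * prob_quadrant_ge[OF v u \<rho>[folded eq] _ \<open>s \<le> t\<close>]] \<rho> \<rho>1 m
      by (simp add: eq conj_commute mult_ac)
  qed
qed

text \<open>Sum of four contributions: 1 + 8 exp 10 from labels that keep their tail up to a
  constant, 256 from the Bessel charge, 1 for the conditioned label itself, and 1 for all truncation
  errors together.\<close>

definition list_const :: real where
  "list_const = 259 + 8 * exp 10"

text \<open>One bound serves all sizes of the correlation r, so that Bessel can be summed without
  counting labels. For small r the tail survives up to a constant. For medium r the shifted tail is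
  at most exp (- \<open>l\<close> / 32) <= \<open>l\<close>^(-2) < r^2. For r > 1/16 the charge 256
  r^2 already exceeds 1.\<close>

lemma prob_triple_le:
  assumes u: "dot d u u = 1" and v: "dot d v v = 1" and y: "dot d y y = 1"
    and orth: "dot d u y = 0" and vy: "dot d v y \<ge> 0"
    and l: "l \<ge> 16" "l\<^sup>2 * exp (- l / 32) \<le> 1"
    and t': "sqrt l / 2 \<le> t'" "t' \<le> 2 * sqrt l"
  shows "measure (gauss d) {g \<in> space (gauss d). (dot d u g \<ge> s \<and> dot d v g \<ge> t) \<and> dot d y g \<ge> t'}
    \<le> ((1 + 8 * exp 10) * gaussian_tail t' + 256 * (dot d y (unit_vec d (\<lambda>k. v k - dot d u v * u k)))\<^sup>2)
        * measure (gauss d) {g \<in> space (gauss d). dot d u g \<ge> s \<and> dot d v g \<ge> t}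
      + gaussian_tail (4 * sqrt l)"
proof -
  define r where "r = dot d y (unit_vec d (\<lambda>k. v k - dot d u v * u k))"
  define P where "P = measure (gauss d) {g \<in> space (gauss d). dot d u g \<ge> s \<and> dot d v g \<ge> t}"
  define Q where "Q = measure (gauss d) {g \<in> space (gauss d). (dot d u g \<ge> s \<and> dot d v g \<ge> t) \<and> dot d y g \<ge> t'}"
  \<comment> \<open>Orthogonality of \<open>u\<close> and \<open>y\<close> removes the correction
    term, leaving \<open>dot d v y\<close> divided by a norm; in the application its sign is an SDP
    constraint.\<close>
  have r0: "r \<ge> 0"
    using vy orth by (simp add: r_def dot_unit_right dot_commute[of d y])
  have sq: "sqrt l \<ge> 4" using l by (intro real_le_rsqrt) auto
  have P0: "P \<ge> 0" by (simp add: P_def)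
  have near: "Q \<le> gaussian_tail (t' - r * (4 * sqrt l)) * P + gaussian_tail (4 * sqrt l)"
    if "t' - r * (4 * sqrt l) > 0"
    unfolding Q_def P_def using that r0 l by (intro prob_quadrant_halfspace_le u y orth r_def) auto
  have nn: "(1 + 8 * exp 10) * gaussian_tail t' \<ge> 0" by (simp add: gaussian_tail_nonneg)
  consider "r \<le> 1 / l" | "1 / l < r" "r \<le> 1 / 16" | "r > 1 / 16" by linarith
  then have "\<exists>\<kappa>. \<kappa> \<le> (1 + 8 * exp 10) * gaussian_tail t' + 256 * r\<^sup>2 \<and> Q \<le> \<kappa> * P + gaussian_tail (4 * sqrt l)"
  proof cases
    case 1
    define \<delta> where "\<delta> = r * (4 * sqrt l)"
    have "\<delta> \<le> 1 / l * (4 * sqrt l)" unfolding \<delta>_def using 1 l by (intro mult_right_mono) auto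
    also have "\<dots> = 4 / sqrt l" using l by (simp add: real_div_sqrt field_simps)
    finally have \<delta>: "\<delta> \<le> 4 / sqrt l" .
    also have "\<dots> \<le> 1" using sq by (subst divide_le_eq_1_pos) linarith+
    finally have "\<delta> \<le> 1" .
    have "t' \<ge> 2" using t' sq by linarith
    \<comment> \<open>This product is the parameter of \<open>gaussian_tail_shift_le\<close>; its
      bound 8 produces the constant 1 + 8 exp 10.\<close>
    have "t' * \<delta> \<le> (2 * sqrt l) * (4 / sqrt l)"
      using t' \<delta> \<open>t' \<ge> 2\<close> r0 l by (intro mult_mono) (auto simp: \<delta>_def)
    also have "\<dots> = 8" using l by simp
    finally have "gaussian_tail (t' - \<delta>) \<le> (1 + 8 * exp (8 + 2)) * gaussian_tail t'"
      using \<open>\<delta> \<le> 1\<close> \<open>t' \<ge> 2\<close> r0 l by (intro gaussian_tail_shift_le) (auto simp: \<delta>_def)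
    moreover have "Q \<le> gaussian_tail (t' - \<delta>) * P + gaussian_tail (4 * sqrt l)"
      using near \<open>\<delta> \<le> 1\<close> \<open>t' \<ge> 2\<close> by (simp add: \<delta>_def)
    ultimately show ?thesis by (intro exI[of _ "gaussian_tail (t' - \<delta>)"]) (auto intro: order_trans)
  next
    case 2
    have "r * (4 * sqrt l) \<le> 1 / 16 * (4 * sqrt l)" using 2 l by (intro mult_right_mono) auto
    then have ge: "t' - r * (4 * sqrt l) \<ge> sqrt l / 4" using t' by simp
    have "gaussian_tail (t' - r * (4 * sqrt l)) \<le> gaussian_tail (sqrt l / 4)"
      by (rule gaussian_tail_antimono[OF ge])
    also have "\<dots> \<le> exp (- (sqrt l / 4)\<^sup>2 / 2)"
      using sq by (intro gaussian_tail_le_exp) simp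
    also have "\<dots> = 1 * exp (- l / 32)" using l by (simp add: power_divide)
    also have "\<dots> \<le> (r * l)\<^sup>2 * exp (- l / 32)"
    proof (intro mult_right_mono)
      have "1 \<le> r * l" using 2 l by (simp add: field_simps)
      then show "1 \<le> (r * l)\<^sup>2" by (rule one_le_power)
    qed simp
    also have "\<dots> = r\<^sup>2 * (l\<^sup>2 * exp (- l / 32))" by (simp add: power_mult_distrib)
    also have "\<dots> \<le> r\<^sup>2 * 1" using l by (intro mult_left_mono) auto
    finally have "gaussian_tail (t' - r * (4 * sqrt l)) \<le> r\<^sup>2" by simp
    moreover have "Q \<le> gaussian_tail (t' - r * (4 * sqrt l)) * P + gaussian_tail (4 * sqrt l)"
      by (rule near) (use ge sq in linarith)
    ultimately show ?thesis using nn zero_le_power2[of r]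
      by (intro exI[of _ "gaussian_tail (t' - r * (4 * sqrt l))"]) (auto intro: order_trans)
  next
    case 3
    have "(1 / 16)\<^sup>2 \<le> r\<^sup>2" using 3 by (intro power_mono) auto
    then have "1 \<le> 256 * r\<^sup>2" by (simp add: power2_eq_square)
    moreover have "Q \<le> P" unfolding Q_def P_def
      by (rule gauss.finite_measure_mono) (auto intro: quadrant_sets)
    ultimately have "1 \<le> (1 + 8 * exp 10) * gaussian_tail t' + 256 * r\<^sup>2"
      and "Q \<le> 1 * P + gaussian_tail (4 * sqrt l)"
      using nn gaussian_tail_nonneg[of "4 * sqrt l"] by linarith+
    then show ?thesis by blast
  qed
  then obtain \<kappa> where \<kappa>: "\<kappa> \<le> (1 + 8 * exp 10) * gaussian_tail t' + 256 * r\<^sup>2"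
    and "Q \<le> \<kappa> * P + gaussian_tail (4 * sqrt l)" by blast
  then show ?thesis
    using mult_right_mono[OF \<kappa> P0] unfolding Q_def[symmetric] P_def[symmetric] r_def[symmetric]
    by linarith
qed

text \<open>Divided by the probability of the quadrant, this bounds the conditional expected size of
  the list that contains \<open>a0\<close>. The tails sum to at most 1 by \<open>le\<close>, and the
  squared correlations by Bessel.\<close>

lemma sum_prob_triple_le:
  fixes R :: nat and l :: real
  defines "l \<equiv> ln (real R)"
  assumes A: "finite A" "card A \<le> R" "a0 \<in> A"
    and e: "\<And>a b. a \<in> A \<Longrightarrow> b \<in> A \<Longrightarrow> dot d (e a) (e b) = (if a = b then 1 else 0)"
    and v: "dot d v v = 1" and ve: "\<And>a. a \<in> A \<Longrightarrow> dot d v (e a) \<ge> 0"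
    and l: "l \<ge> 16" "l\<^sup>2 * exp (- l / 32) \<le> 1"
    and t: "\<And>a. a \<in> A \<Longrightarrow> sqrt l / 2 \<le> t a" "\<And>a. a \<in> A \<Longrightarrow> t a \<le> 2 * sqrt l"
    and T: "sqrt l / 2 \<le> T"
    and ge: "gaussian_tail (t a0) \<ge> 1 / (2 * R)" "gaussian_tail T \<ge> 1 / (2 * R)"
    and le: "(\<Sum>a\<in>A. gaussian_tail (t a)) \<le> 1"
  shows "(\<Sum>a\<in>A. measure (gauss d) {g \<in> space (gauss d).
      (dot d (e a0) g \<ge> t a0 \<and> dot d v g \<ge> T) \<and> dot d (e a) g \<ge> t a})
    \<le> list_const * measure (gauss d) {g \<in> space (gauss d). dot d (e a0) g \<ge> t a0 \<and> dot d v g \<ge> T}"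
proof -
  define P where "P = measure (gauss d) {g \<in> space (gauss d). dot d (e a0) g \<ge> t a0 \<and> dot d v g \<ge> T}"
  define Q where "Q a = measure (gauss d) {g \<in> space (gauss d).
      (dot d (e a0) g \<ge> t a0 \<and> dot d v g \<ge> T) \<and> dot d (e a) g \<ge> t a}" for a
  define w where "w = unit_vec d (\<lambda>k. v k - dot d (e a0) v * e a0 k)"
  define \<kappa> where "\<kappa> a = (1 + 8 * exp 10) * gaussian_tail (t a) + 256 * (dot d (e a) w)\<^sup>2" for a
  define \<epsilon> where "\<epsilon> = gaussian_tail (4 * sqrt l)"
  have u: "dot d (e a0) (e a0) = 1" using e A by simp
  have P0: "P \<ge> 0" by (simp add: P_def)
  have R: "real R \<ge> 2"
  proof -
    have "R \<noteq> 0" using l by (intro notI) (simp add: l_def)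
    then have "real R = exp l" by (simp add: l_def)
    moreover have "exp 1 \<le> exp l" using l by simp
    ultimately show ?thesis using exp_ge_add_one_self[of 1] by linarith
  qed
  have sq: "sqrt l \<ge> 4" using l by (intro real_le_rsqrt) auto
  have P_ge: "1 / (4 * real R ^ 2) \<le> P"
  proof -
    have \<rho>: "dot d (e a0) v \<ge> 0" using ve[OF A(3)] by (simp add: dot_commute)
    have "1 / (4 * real R ^ 2) = 1 / (2 * R) * (1 / (2 * R))" by (simp add: power2_eq_square)
    also have "\<dots> \<le> gaussian_tail (t a0) * gaussian_tail T"
      using ge by (intro mult_mono) (auto simp: gaussian_tail_nonneg)
    also have "\<dots> \<le> P"
      using prob_quadrant_ge'[OF u v \<rho>, of 0 "t a0" T] t(1)[OF A(3)] T sq unfolding P_def by simp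
    finally show ?thesis .
  qed
  \<comment> \<open>The cutoff 4 sqrt \<open>l\<close> gives a tail of at most
    \<open>R\<close>^(-8), so even \<open>R\<close> such errors stay below the lower bound on
    \<open>P\<close>.\<close>
  have \<epsilon>: "real R * \<epsilon> \<le> P"
  proof -
    have "\<epsilon> \<le> exp (- (4 * sqrt l)\<^sup>2 / 2)"
      unfolding \<epsilon>_def using sq by (intro gaussian_tail_le_exp) simp
    also have "\<dots> = exp (- l) ^ 8" using l by (simp add: power_mult_distrib exp_of_nat_mult[symmetric])
    also have "exp (- l) = 1 / real R" using R by (simp add: l_def exp_minus inverse_eq_divide)
    finally have "real R * \<epsilon> \<le> real R * (1 / real R) ^ 8" by (intro mult_left_mono) auto
    also have "\<dots> = 1 / (real R ^ 5 * real R ^ 2)" using R by (simp add: power_divide eval_nat_numeral)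
    also have "\<dots> \<le> 1 / (4 * real R ^ 2)"
    proof -
      have "(4::real) \<le> 2 ^ 5" by simp
      also have "\<dots> \<le> real R ^ 5" using R by (intro power_mono) auto
      finally show ?thesis using R by (intro divide_left_mono mult_right_mono mult_pos_pos) auto
    qed
    finally show ?thesis using P_ge by linarith
  qed
  have "Q a0 = P" unfolding Q_def P_def by (rule arg_cong[of _ _ "measure (gauss d)"]) auto
  have "(\<Sum>a\<in>A. Q a) = Q a0 + (\<Sum>a\<in>A - {a0}. Q a)"
    using A by (simp add: sum.remove)
  also have "(\<Sum>a\<in>A - {a0}. Q a) \<le> (\<Sum>a\<in>A - {a0}. \<kappa> a * P + \<epsilon>)"
  proof (intro sum_mono)
    fix a assume a: "a \<in> A - {a0}"
    then show "Q a \<le> \<kappa> a * P + \<epsilon>"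
      unfolding Q_def \<kappa>_def P_def \<epsilon>_def w_def
      using A e[of a0 a] e[of a a] by (intro prob_triple_le u v ve l t) auto
  qed
  also have "\<dots> \<le> (\<Sum>a\<in>A. \<kappa> a * P + \<epsilon>)"
    using A P0 by (intro sum_mono2) (auto simp: \<kappa>_def \<epsilon>_def gaussian_tail_nonneg)
  also have "\<dots> = (\<Sum>a\<in>A. \<kappa> a) * P + real (card A) * \<epsilon>"
    by (simp add: sum.distrib sum_distrib_right)
  also have "\<dots> \<le> (257 + 8 * exp 10) * P + P"
  proof (rule add_mono)
    have "(\<Sum>a\<in>A. \<kappa> a) = (1 + 8 * exp 10) * (\<Sum>a\<in>A. gaussian_tail (t a)) + 256 * (\<Sum>a\<in>A. (dot d (e a) w)\<^sup>2)"
      by (simp add: \<kappa>_def sum.distrib sum_distrib_left)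
    also have "\<dots> \<le> (1 + 8 * exp 10) * 1 + 256 * 1"
    proof (intro add_mono mult_left_mono le)
      have "(\<Sum>a\<in>A. (dot d (e a) w)\<^sup>2) \<le> dot d w w" by (rule bessel_dot[OF A(1) e])
      also have "\<dots> \<le> 1" unfolding w_def dot_unit_unit by simp
      finally show "(\<Sum>a\<in>A. (dot d (e a) w)\<^sup>2) \<le> 1" .
    qed auto
    finally show "(\<Sum>a\<in>A. \<kappa> a) * P \<le> (257 + 8 * exp 10) * P"
      using P0 by (intro mult_right_mono) auto
    have "real (card A) * \<epsilon> \<le> real R * \<epsilon>"
      using A by (intro mult_right_mono) (auto simp: \<epsilon>_def gaussian_tail_nonneg)
    then show "real (card A) * \<epsilon> \<le> P" using \<epsilon> by linarith
  qed
  finally show ?thesis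
    unfolding P_def[symmetric] Q_def[symmetric] \<open>Q a0 = P\<close> list_const_def by (simp add: algebra_simps)
qed

section \<open>The rounding algorithm\<close>

lemma normalized_memD:
  assumes I: "max_2csp R I" and m: "(i, a, j, b) \<in># normalized I"
  shows "i < num_vars I" "j < num_vars I" "i \<noteq> j" "a \<in> alphabet I" "b \<in> alphabet I"
proof -
  have fin: "finite {(a, b). a \<in> alphabet I \<and> b \<in> alphabet I \<and> f a b}" for f
    by (rule finite_subset[of _ "alphabet I \<times> alphabet I"]) (use I in \<open>auto simp: max_2csp_def\<close>)
  obtain f where "(i, j, f) \<in># constrs I" "a \<in> alphabet I" "b \<in> alphabet I"
    using m fin by (auto simp: normalized_def)
  then show "i < num_vars I" "j < num_vars I" "i \<noteq> j" "a \<in> alphabet I" "b \<in> alphabet I"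
    using I by (auto simp: max_2csp_def)
qed

lemma size_filter_mset_conv: "real (size (filter_mset P M)) = (\<Sum>c\<in>#M. if P c then 1 else 0)"
  by (induction M) auto

text \<open>Only an inequality holds for arbitrary \<open>Z\<close>: a predicate may accept symbols
  outside the alphabet, which normalisation ignores. It suffices for a pointwise comparison of
  integrands and avoids an argument about the support of \<open>rounding\<close>.\<close>

lemma num_sat_ge_normalized:
  assumes "finite (alphabet I)"
  shows "size {#(i, a, j, b) \<in># normalized I. Z i = Some a \<and> Z j = Some b#} \<le> num_sat I Z"
proof -
  define Z' where "Z' i = (if Z i \<in> Some ` alphabet I then Z i else None)" for i
  have alph: "a \<in> alphabet I \<and> b \<in> alphabet I" if "(i, a, j, b) \<in># normalized I" for i a j b
  proof -
    have fin: "finite {(a, b). a \<in> alphabet I \<and> b \<in> alphabet I \<and> f a b}" for f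
      by (rule finite_subset[of _ "alphabet I \<times> alphabet I"]) (use assms in auto)
    show ?thesis using that fin by (auto simp: normalized_def)
  qed
  have "{#(i, a, j, b) \<in># normalized I. Z i = Some a \<and> Z j = Some b#}
      = {#(i, a, j, b) \<in># normalized I. Z' i = Some a \<and> Z' j = Some b#}"
    by (rule filter_mset_cong) (auto simp: Z'_def dest: alph split: if_splits)
  also have "size \<dots> = num_sat I Z'"
    by (rule num_sat_normalized) (use assms in \<open>auto simp: Z'_def split: if_splits\<close>)
  also have "\<dots> \<le> num_sat I Z"
    unfolding num_sat_def
    by (intro size_mset_mono filter_mset_mono_strong) (auto simp: Z'_def split: if_splits)
  finally show ?thesis .
qed

lemma OPT_le_sdp_value:
  assumes I: "max_2csp R I" and x: "sdp_optimal I d x" and R: "R > 0"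
  shows "real (OPT I) \<le> sdp_value I d x"
proof -
  have fin: "finite (alphabet I)" and ne: "alphabet I \<noteq> {}"
    using I R by (auto simp: max_2csp_def)
  let ?S = "{..<num_vars I} \<rightarrow>\<^sub>E alphabet I"
  have "finite ?S" "?S \<noteq> {}" using fin ne by (auto simp: PiE_eq_empty_iff intro: finite_PiE)
  then have "OPT I \<in> (\<lambda>\<sigma>. num_sat I (Some \<circ> \<sigma>)) ` ?S"
    unfolding OPT_def by (intro Max_in) auto
  then obtain \<sigma> where \<sigma>: "\<sigma> \<in> ?S" and opt: "OPT I = num_sat I (Some \<circ> \<sigma>)" by blast
  define y :: "nat \<Rightarrow> nat \<Rightarrow> nat \<Rightarrow> real" where "y i a k = (if k = 0 \<and> \<sigma> i = a then 1 else 0)" for i a k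
  \<comment> \<open>Outside the variables \<sigma> takes an unspecified value that may lie outside
    the alphabet; \<open>None\<close> there meets the hypothesis of
    \<open>num_sat_normalized\<close>.\<close>
  define Z where "Z i = (if i < num_vars I then Some (\<sigma> i) else None)" for i
  show ?thesis
  proof (cases "num_vars I = 0")
    case True
    then have "constrs I = {#}" using I by (cases "constrs I") (auto simp: max_2csp_def)
    then show ?thesis by (simp add: opt num_sat_def sdp_value_def normalized_def)
  next
    case False
    \<comment> \<open>The comparison solution \<open>y\<close> needs one coordinate. Feasibility of
      \<open>x\<close> at some variable excludes dimension 0, hence the separate case of no
      variables.\<close>
    have "(\<Sum>a\<in>alphabet I. (L2_set (x 0 a) {..<d})\<^sup>2) = 1"
      using x False by (simp add: sdp_optimal_def sdp_feasible_def)
    then have "d \<noteq> 0" by (intro notI) simp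
    have dot_y: "dot d (y i a) (y j b) = (if \<sigma> i = a \<and> \<sigma> j = b then 1 else 0)" for i a j b
      using \<open>d \<noteq> 0\<close> unfolding dot_def y_def by (subst sum.remove[of _ 0]) auto
    have "sdp_feasible I d y"
      unfolding sdp_feasible_def dot_self[symmetric] dot_y
      using fin \<sigma> by (auto simp: PiE_iff)
    then have "sdp_value I d y \<le> sdp_value I d x" using x by (simp add: sdp_optimal_def)
    moreover have "sdp_value I d y = real (num_sat I Z)"
    proof -
      have "sdp_value I d y = (\<Sum>(i, a, j, b) \<in># normalized I. if Z i = Some a \<and> Z j = Some b then 1 else 0)"
        unfolding sdp_value_def dot_y
        by (intro arg_cong[where f=sum_mset] image_mset_cong)
           (auto simp: Z_def dest: normalized_memD[OF I])
      also have "\<dots> = real (size {#(i, a, j, b) \<in># normalized I. Z i = Some a \<and> Z j = Some b#})"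
        unfolding size_filter_mset_conv by (intro arg_cong[where f=sum_mset] image_mset_cong) (auto split: if_splits)
      also have "\<dots> = real (num_sat I Z)"
        using fin \<sigma> by (subst num_sat_normalized) (auto simp: Z_def PiE_iff split: if_splits)
      finally show ?thesis .
    qed
    moreover have "num_sat I Z = OPT I"
      unfolding opt num_sat_def using I
      by (intro arg_cong[where f=size] filter_mset_cong) (auto simp: Z_def max_2csp_def)
    ultimately show ?thesis by simp
  qed
qed

lemma inverse_mult_ge:
  fixes x y M :: real
  assumes "x > 0" "y > 0" "M > 0"
  shows "(3 - x / M - y / M) / M\<^sup>2 \<le> 1 / (x * y)"
proof -
  define s where "s = (x + y) / M"
  have s: "s > 0" using assms by (simp add: s_def)
  have "3 - s \<le> 4 / s\<^sup>2"
  proof -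
    have "0 \<le> (s - 2)\<^sup>2 * (s + 1)" using s by simp
    also have "\<dots> = 4 - (3 - s) * s\<^sup>2" by algebra
    finally show ?thesis using s by (simp add: pos_le_divide_eq)
  qed
  then have "(3 - x / M - y / M) / M\<^sup>2 \<le> (4 / s\<^sup>2) / M\<^sup>2"
    using assms by (intro divide_right_mono) (auto simp: s_def add_divide_distrib)
  also have "\<dots> = 4 / (x + y)\<^sup>2" using assms by (simp add: s_def power_divide)
  also have "\<dots> \<le> 1 / (x * y)"
  proof -
    have "0 \<le> (x - y)\<^sup>2" by simp
    then have "4 * (x * y) \<le> (x + y)\<^sup>2" by (simp add: power2_eq_square algebra_simps)
    then show ?thesis using assms by (simp add: field_simps)
  qed
  finally show ?thesis .
qed

section \<open>Sampling from the lists\<close>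

lemma pmf_choose_from:
  assumes "finite L" "a \<in> L"
  shows "pmf (choose_from L) (Some a) = 1 / card L"
proof -
  have "L \<noteq> {}" using assms by auto
  moreover have "pmf (map_pmf Some (pmf_of_set L)) (Some a) = pmf (pmf_of_set L) a"
    by (rule pmf_map_inj') simp
  ultimately show ?thesis using assms by (simp add: choose_from_def)
qed

lemma prob_choose_pair:
  fixes n i j :: nat
  assumes ij: "i < n" "j < n" "i \<noteq> j" and L: "finite (L i)" "finite (L j)" "a \<in> L i" "b \<in> L j"
  shows "measure_pmf.prob (Pi_pmf {..<n} None (\<lambda>i. choose_from (L i))) {Z. Z i = Some a \<and> Z j = Some b}
    = 1 / (real (card (L i)) * real (card (L j)))"
proof -
  let ?B = "\<lambda>k. if k = i then {Some a} else if k = j then {Some b} else UNIV"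
  have S: "{Z. Z i = Some a \<and> Z j = Some b} = Pi {..<n} ?B"
    using ij by (auto simp: Pi_iff) (metis lessThan_iff option.inject singletonD)+
  have "measure_pmf.prob (Pi_pmf {..<n} None (\<lambda>i. choose_from (L i))) {Z. Z i = Some a \<and> Z j = Some b}
      = (\<Prod>k<n. measure_pmf.prob (choose_from (L k)) (?B k))"
    unfolding S by (rule measure_Pi_pmf_Pi) simp
  also have "\<dots> = measure_pmf.prob (choose_from (L i)) (?B i) *
      (measure_pmf.prob (choose_from (L j)) (?B j) *
       (\<Prod>k\<in>{..<n} - {i} - {j}. measure_pmf.prob (choose_from (L k)) (?B k)))"
    using ij by (subst prod.remove[of _ i], simp, simp, subst prod.remove[of _ j]) auto
  also have "(\<Prod>k\<in>{..<n} - {i} - {j}. measure_pmf.prob (choose_from (L k)) (?B k)) = 1"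
    by (intro prod.neutral) (auto simp: measure_pmf.prob_space[simplified])
  also have "measure_pmf.prob (choose_from (L i)) (?B i) = 1 / card (L i)"
    using L by (simp add: measure_pmf_single pmf_choose_from)
  also have "measure_pmf.prob (choose_from (L j)) (?B j) = 1 / card (L j)"
    using L ij by (simp add: measure_pmf_single pmf_choose_from)
  finally show ?thesis by simp
qed


lemma prob_rounding_pair:
  assumes fin: "finite (alphabet I)"
  shows "measure (rounding I d x) S
    = (\<integral>g. measure_pmf.prob (Pi_pmf {..<num_vars I} None (\<lambda>i. choose_from (L_round I d x g i))) S \<partial>gauss d)"
    and "(\<lambda>g. measure_pmf.prob (Pi_pmf {..<num_vars I} None (\<lambda>i. choose_from (L_round I d x g i))) S)
      \<in> borel_measurable (gauss d)"
proof -
  show "measure (rounding I d x) S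
    = (\<integral>g. measure_pmf.prob (Pi_pmf {..<num_vars I} None (\<lambda>i. choose_from (L_round I d x g i))) S \<partial>gauss d)"
    unfolding rounding_def
    by (rule gauss.measure_bind[OF measurable_rounding_kernel[OF fin]]) simp
  show "(\<lambda>g. measure_pmf.prob (Pi_pmf {..<num_vars I} None (\<lambda>i. choose_from (L_round I d x g i))) S)
      \<in> borel_measurable (gauss d)"
    by (rule measurable_compose[OF measurable_rounding_kernel[OF fin] measurable_measure_subprob_algebra]) simp
qed

text \<open>The first bound caps the thresholds from above, the third from below. The second
  compares tails with vector lengths and hence with the SDP value. The last bounds the sum of the
  tails of all labels of a variable.\<close>

lemma p_round_bounds:
  fixes R :: nat
  assumes feas: "sdp_feasible I d x" and I: "max_2csp R I" and R: "R > 1" and i: "i < num_vars I"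
  shows "a \<in> alphabet I \<Longrightarrow> 1 / (2 * R) \<le> p_round I d x i a"
    and "a \<in> alphabet I \<Longrightarrow> L2_set (x i a) {..<d} / (2 * sqrt R) \<le> p_round I d x i a"
    and "a \<in> alphabet I \<Longrightarrow> p_round I d x i a \<le> 1 / sqrt R"
    and "(\<Sum>a\<in>alphabet I. p_round I d x i a) \<le> 1"
proof -
  have card: "card (alphabet I) = R" and fin: "finite (alphabet I)" using I by (auto simp: max_2csp_def)
  have one: "(\<Sum>a\<in>alphabet I. (L2_set (x i a) {..<d})\<^sup>2) = 1" using feas i by (simp add: sdp_feasible_def)
  have p: "p_round I d x i a = (L2_set (x i a) {..<d} / sqrt R + 1 / R) / 2" for a
    by (simp add: p_round_def card Let_def)
  show "1 / (2 * R) \<le> p_round I d x i a" "L2_set (x i a) {..<d} / (2 * sqrt R) \<le> p_round I d x i a"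
    by (simp_all add: p add_divide_distrib mult.commute)
  show "p_round I d x i a \<le> 1 / sqrt R" if a: "a \<in> alphabet I"
  proof -
    have "(L2_set (x i a) {..<d})\<^sup>2 \<le> 1\<^sup>2"
      using member_le_sum[OF a, of "\<lambda>a. (L2_set (x i a) {..<d})\<^sup>2"] fin one by simp
    then have "L2_set (x i a) {..<d} \<le> 1" by (rule power2_le_imp_le) simp
    then have "L2_set (x i a) {..<d} / sqrt R \<le> 1 / sqrt R" by (intro divide_right_mono) auto
    moreover have "1 / real R \<le> 1 / sqrt R"
    proof -
      have "sqrt R * 1 \<le> sqrt R * sqrt R" using R by (intro mult_left_mono) auto
      then have "sqrt R \<le> R" by simp
      then show ?thesis using R by (intro divide_left_mono) auto
    qed
    moreover have "(u + v) / 2 \<le> w" if "u \<le> w" "v \<le> w" for u v w :: real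
      using that by simp
    ultimately show ?thesis unfolding p by blast
  qed
  \<comment> \<open>AM-GM trades the product of the norm with 1 / sqrt \<open>R\<close> for squares,
    whose sum is known from the normalisation constraint; the total is (1 + 3) / 4.\<close>
  have "p_round I d x i a \<le> ((L2_set (x i a) {..<d})\<^sup>2 + 3 / R) / 4" for a
  proof -
    have "0 \<le> (L2_set (x i a) {..<d} - 1 / sqrt R)\<^sup>2" by simp
    also have "\<dots> = (L2_set (x i a) {..<d})\<^sup>2 + 1 / R - 2 * (L2_set (x i a) {..<d} / sqrt R)"
      by (simp add: power2_diff power_divide)
    finally show ?thesis unfolding p by (simp add: field_simps)
  qed
  then have "(\<Sum>a\<in>alphabet I. p_round I d x i a) \<le> (\<Sum>a\<in>alphabet I. ((L2_set (x i a) {..<d})\<^sup>2 + 3 / R) / 4)"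
    by (intro sum_mono)
  also have "\<dots> = 1"
    using R by (simp add: sum_divide_distrib[symmetric] sum.distrib one card)
  finally show "(\<Sum>a\<in>alphabet I. p_round I d x i a) \<le> 1" .
qed

lemma gaussian_tail_t_round:
  assumes "sdp_feasible I d x" "max_2csp R I" "R > 1" "i < num_vars I" "a \<in> alphabet I"
  shows "gaussian_tail (t_round I d x i a) = p_round I d x i a"
proof -
  have "0 < 1 / (2 * real R)" "1 / sqrt (real R) < 1" using assms by auto
  then have "0 < p_round I d x i a" "p_round I d x i a < 1"
    using p_round_bounds(1,3)[OF assms] by linarith+
  from theI'[OF gaussian_tail_ex1[OF this]] show ?thesis
    by (simp add: t_round_def)
qed

lemma threshold_bounds:
  fixes R :: nat and l :: real
  defines "l \<equiv> ln (real R)"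
  assumes "sdp_feasible I d x" "max_2csp R I" "R > 1" "i < num_vars I" "a \<in> alphabet I"
    and l: "l \<ge> 16" "exp (- l / 2) * exp 2 * (sqrt l / 2) < std_normal_density (sqrt l / 2)"
  shows "sqrt l / 2 \<le> t_round I d x i a" "t_round I d x i a \<le> 2 * sqrt l"
proof -
  have R: "exp (- l) = 1 / R" using assms(4) by (simp add: l_def exp_minus inverse_eq_divide)
  have "exp (- l / 2) = sqrt (exp (- l))"
    by (rule real_sqrt_unique[symmetric]) (auto simp: power2_eq_square exp_add[symmetric])
  then have R2: "exp (- l / 2) = 1 / sqrt R" by (simp add: R real_sqrt_divide)
  show "sqrt l / 2 \<le> t_round I d x i a"
  proof (rule threshold_lower)
    show "gaussian_tail (t_round I d x i a) \<le> exp (- l / 2)"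
      unfolding gaussian_tail_t_round[OF assms(2-6)] R2 by (rule p_round_bounds(3)[OF assms(2-6)])
  qed (use l in auto)
  show "t_round I d x i a \<le> 2 * sqrt l"
  proof (rule threshold_upper)
    show "exp (- l) / 2 \<le> gaussian_tail (t_round I d x i a)"
      unfolding gaussian_tail_t_round[OF assms(2-6)] R using p_round_bounds(1)[OF assms(2-6)] by simp
  qed (use l in auto)
qed

lemma L_round_eq:
  "L_round I d x g i = {a \<in> alphabet I. L2_set (x i a) {..<d} \<noteq> 0
      \<and> t_round I d x i a \<le> dot d (unit_vec d (x i a)) g}"
proof -
  have "(\<exists>k<d. x i a k \<noteq> 0) \<longleftrightarrow> L2_set (x i a) {..<d} \<noteq> 0" for a
    by (auto simp: L2_set_eq_0_iff)
  moreover have "t_round I d x i a \<le> dot d (unit_vec d (x i a)) g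
      \<longleftrightarrow> L2_set (x i a) {..<d} * t_round I d x i a \<le> dot d (x i a) g"
    if "L2_set (x i a) {..<d} \<noteq> 0" for a
  proof -
    have "L2_set (x i a) {..<d} > 0" using that by (simp add: less_le)
    then show ?thesis by (simp add: dot_unit_left pos_le_divide_eq mult.commute)
  qed
  ultimately show ?thesis unfolding L_round_def by blast
qed

lemma prob_pair_ge:
  fixes R :: nat and l :: real
  defines "l \<equiv> ln (real R)"
  assumes I: "max_2csp R I" and feas: "sdp_feasible I d x"
    and l: "l \<ge> 16" "l\<^sup>2 * exp (- l / 32) \<le> 1"
      "exp (- l / 2) * exp 2 * (sqrt l / 2) < std_normal_density (sqrt l / 2)"
    and ij: "i < num_vars I" "j < num_vars I" "i \<noteq> j" and ab: "a \<in> alphabet I" "b \<in> alphabet I"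
  shows "measure (rounding I d x) {Z. Z i = Some a \<and> Z j = Some b}
    \<ge> 1 / (32 * list_const\<^sup>2) * (l / R) * dot d (x i a) (x j b)"
proof (cases "L2_set (x i a) {..<d} = 0 \<or> L2_set (x j b) {..<d} = 0")
  case True
  then have "dot d (x i a) (x j b) = 0" by (auto simp: dot_def L2_set_eq_0_iff)
  then show ?thesis by simp
next
  case False
  have card: "card (alphabet I) = R" and fin: "finite (alphabet I)" using I by (auto simp: max_2csp_def)
  have R: "R > 1"
  proof (rule ccontr)
    assume "\<not> R > 1"
    then have "R = 0 \<or> R = 1" by auto
    then show False using l by (auto simp: l_def)
  qed
  define n where "n i a = L2_set (x i a) {..<d}" for i a
  define e where "e i a = unit_vec d (x i a)" for i a
  define t where "t i a = t_round I d x i a" for i a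
  \<comment> \<open>Labels with zero vector never enter a list, and the remaining normalised vectors
    are orthonormal, as Bessel requires.\<close>
  define A where "A i = {a \<in> alphabet I. n i a \<noteq> 0}" for i
  define L where "L g i = {a \<in> A i. t i a \<le> dot d (e i a) g}" for g i
  define M where "M = list_const"
  have M: "M > 0" by (simp add: M_def list_const_def add_pos_pos)
  have finA: "finite (A i)" for i using fin by (simp add: A_def)
  have cardA: "card (A i) \<le> R" for i unfolding card[symmetric] A_def by (intro card_mono fin) auto
  have finL: "finite (L g i)" for g i using finA by (simp add: L_def)
  have L: "L_round I d x g i = L g i" for g i
    unfolding L_round_eq L_def A_def t_def e_def n_def by auto
  have aA: "a \<in> A i" and bA: "b \<in> A j" using False ab by (auto simp: A_def n_def)
  have n0: "n i a \<ge> 0" for i a by (simp add: n_def)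
  have orth: "dot d (e k a) (e k b) = (if a = b then 1 else 0)" if "k < num_vars I" "a \<in> A k" "b \<in> A k" for k a b
  proof (cases "a = b")
    case True
    then show ?thesis using that by (simp add: e_def dot_unit_unit A_def n_def)
  next
    case False
    then show ?thesis using that feas by (simp add: e_def dot_unit_left dot_unit_right A_def sdp_feasible_def)
  qed
  have one: "dot d (e i a) (e i a) = 1" "dot d (e j b) (e j b) = 1"
    using orth[of i a a] orth[of j b b] ij aA bA by auto
  have nonneg: "dot d (e k a) (e m b) \<ge> 0"
    if "k < num_vars I" "m < num_vars I" "a \<in> alphabet I" "b \<in> alphabet I" for k m a b
    using that feas by (simp add: e_def dot_unit_left dot_unit_right sdp_feasible_def)
  have tail: "gaussian_tail (t k a) = p_round I d x k a" if "k < num_vars I" "a \<in> alphabet I" for k a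
    unfolding t_def by (rule gaussian_tail_t_round[OF feas I R that])
  have t: "sqrt l / 2 \<le> t k a" "t k a \<le> 2 * sqrt l" if "k < num_vars I" "a \<in> alphabet I" for k a
    unfolding t_def l_def using threshold_bounds[OF feas I R that] l by (simp_all add: l_def)
  have tail_ge: "1 / (2 * R) \<le> gaussian_tail (t k a)" if "k < num_vars I" "a \<in> alphabet I" for k a
    using p_round_bounds(1)[OF feas I R that] tail[OF that] by simp
  have p_nonneg: "0 \<le> p_round I d x k a" if "k < num_vars I" "a \<in> alphabet I" for k a
    using gaussian_tail_nonneg[of "t k a"] tail[OF that] by simp
  have tail_sum: "(\<Sum>a\<in>A k. gaussian_tail (t k a)) \<le> 1" if "k < num_vars I" for k
  proof -
    have "(\<Sum>a\<in>A k. gaussian_tail (t k a)) \<le> (\<Sum>a\<in>alphabet I. gaussian_tail (t k a))"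
      by (intro sum_mono2 fin) (auto simp: A_def gaussian_tail_nonneg)
    also have "\<dots> = (\<Sum>a\<in>alphabet I. p_round I d x k a)" using tail[OF that] by simp
    finally show ?thesis using p_round_bounds(4)[OF feas I R that] by simp
  qed
  define E where "E = {g \<in> space (gauss d). dot d (e i a) g \<ge> t i a \<and> dot d (e j b) g \<ge> t j b}"
  define F where "F k c = {g \<in> space (gauss d).
      (dot d (e i a) g \<ge> t i a \<and> dot d (e j b) g \<ge> t j b) \<and> dot d (e k c) g \<ge> t k c}" for k c
  have E: "E \<in> sets (gauss d)" and F: "F k c \<in> sets (gauss d)" for k c
    unfolding E_def F_def by measurable
  have sum_i: "(\<Sum>c\<in>A i. measure (gauss d) (F i c)) \<le> M * measure (gauss d) E"
    unfolding F_def E_def M_def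
    by (intro sum_prob_triple_le[where R=R, folded l_def] finA cardA aA orth nonneg tail_ge tail_sum t l ij ab one)
      (auto simp: A_def)
  \<comment> \<open>The second list bound is the first with (\<open>i\<close>, \<open>a\<close>) and
    (\<open>j\<close>, \<open>b\<close>) exchanged, so the two half-spaces must be
    reordered.\<close>
  have swap: "(P \<and> Q) \<and> S \<longleftrightarrow> (Q \<and> P) \<and> S" "P \<and> Q \<longleftrightarrow> Q \<and> P" for P Q S by auto
  have sum_j: "(\<Sum>c\<in>A j. measure (gauss d) (F j c)) \<le> M * measure (gauss d) E"
    unfolding F_def E_def M_def
    by (subst swap(1), subst swap(2),
        intro sum_prob_triple_le[where R=R, folded l_def] finA cardA bA orth nonneg tail_ge tail_sum t l ij ab one)
      (auto simp: A_def)
  have E_ge: "measure (gauss d) E \<ge> n i a * n j b / (4 * R) * (dot d (e i a) (e j b) * l / 8)"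
  proof -
    have "n i a * n j b / (4 * R) = n i a / (2 * sqrt R) * (n j b / (2 * sqrt R))"
      by simp
    also have "\<dots> \<le> gaussian_tail (t i a) * gaussian_tail (t j b)"
      using p_round_bounds(2)[OF feas I R] ij ab n0
      by (intro mult_mono) (auto simp: tail n_def[symmetric] p_nonneg)
    finally have 1: "n i a * n j b / (4 * R) \<le> gaussian_tail (t i a) * gaussian_tail (t j b)" .
    \<comment> \<open>The baseline 1 is given up: only the correlation part, multiplied by the two
      norms, matches the SDP term. The factors 4 and 8 make up the 32 of the final constant.\<close>
    have "dot d (e i a) (e j b) * l / 8 \<le> 1 + dot d (e i a) (e j b) * (sqrt l / 2)\<^sup>2 / 2"
      using l by (simp add: power_divide)
    then have "n i a * n j b / (4 * R) * (dot d (e i a) (e j b) * l / 8)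
      \<le> gaussian_tail (t i a) * gaussian_tail (t j b) * (1 + dot d (e i a) (e j b) * (sqrt l / 2)\<^sup>2 / 2)"
      using 1 l nonneg ij ab by (intro mult_mono) (auto simp: gaussian_tail_nonneg)
    also have "\<dots> \<le> measure (gauss d) E"
      unfolding E_def using orth[of i a a] orth[of j b b] aA bA nonneg t ij ab l
      by (intro prob_quadrant_ge') auto
    finally show ?thesis .
  qed
  define h where "h g = measure_pmf.prob (Pi_pmf {..<num_vars I} None (\<lambda>i. choose_from (L_round I d x g i)))
      {Z. Z i = Some a \<and> Z j = Some b}" for g
  \<comment> \<open>Minorant of the conditional success probability \<open>h\<close>. On
    \<open>E\<close> the indicator sums are the two list sizes, so \<open>inverse_mult_ge\<close>
    applies; off \<open>E\<close> every term vanishes. Its integral only involves probabilities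
    already bounded.\<close>
  define \<psi> where "\<psi> g = (3 * indicator E g - (\<Sum>c\<in>A i. indicator (F i c) g) / M
      - (\<Sum>c\<in>A j. indicator (F j c) g) / M) / M\<^sup>2" for g
  have \<psi>_le: "\<psi> g \<le> h g" if g: "g \<in> space (gauss d)" for g
  proof (cases "g \<in> E")
    case True
    have sumF: "(\<Sum>c\<in>A k. indicator (F k c) g) = real (card (L g k))" for k
    proof -
      have "(\<Sum>c\<in>A k. indicator (F k c) g) = (\<Sum>c\<in>A k. if t k c \<le> dot d (e k c) g then 1 else (0::real))"
        using True by (intro sum.cong) (auto simp: F_def E_def)
      then show ?thesis using finA by (simp add: L_def sum.inter_filter[symmetric])
    qed
    have aL: "a \<in> L g i" and bL: "b \<in> L g j" using True aA bA by (auto simp: L_def E_def)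
    then have "card (L g i) > 0" "card (L g j) > 0" using finL by (auto simp: card_gt_0_iff)
    then have "\<psi> g \<le> 1 / (real (card (L g i)) * real (card (L g j)))"
      using True inverse_mult_ge[of "card (L g i)" "card (L g j)" M] M by (simp add: \<psi>_def sumF)
    also have "\<dots> = h g"
      unfolding h_def L using ij finL aL bL by (intro prob_choose_pair[symmetric])
    finally show ?thesis .
  next
    case False
    then have "g \<notin> F k c" for k c by (auto simp: E_def F_def)
    with False show ?thesis by (simp add: \<psi>_def h_def)
  qed
  have int_ind: "integrable (gauss d) (indicator B :: _ \<Rightarrow> real)" if "B \<in> sets (gauss d)" for B
    using that by (simp add: integrable_indicator_iff gauss.emeasure_eq_measure)
  have int_\<psi>: "integrable (gauss d) \<psi>"
    unfolding \<psi>_def using int_ind E F by (intro integrable_divide Bochner_Integration.integrable_diff integrable_mult_right Bochner_Integration.integrable_sum) auto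
  have int_h: "integrable (gauss d) h"
    unfolding h_def using prob_rounding_pair(2)[OF fin]
    by (intro gauss.integrable_const_bound[of _ 1]) auto
  have ind: "(\<integral>g. indicator B g \<partial>gauss d) = measure (gauss d) B" if "B \<in> sets (gauss d)" for B
    using that sets.sets_into_space by (simp add: Int_absorb2)
  have "(\<integral>g. \<psi> g \<partial>gauss d) = (3 * measure (gauss d) E - (\<Sum>c\<in>A i. measure (gauss d) (F i c)) / M
      - (\<Sum>c\<in>A j. measure (gauss d) (F j c)) / M) / M\<^sup>2"
    unfolding \<psi>_def using int_ind E F
    by (simp add: Bochner_Integration.integral_diff Bochner_Integration.integral_sum ind
      Bochner_Integration.integrable_diff Bochner_Integration.integrable_sum)
  also have "\<dots> \<ge> (3 * measure (gauss d) E - measure (gauss d) E - measure (gauss d) E) / M\<^sup>2"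
    using sum_i sum_j M by (intro divide_right_mono diff_mono) (auto simp: pos_divide_le_eq mult.commute)
  finally have "measure (gauss d) E / M\<^sup>2 \<le> (\<integral>g. \<psi> g \<partial>gauss d)" by simp
  also have "\<dots> \<le> (\<integral>g. h g \<partial>gauss d)"
    by (intro integral_mono int_\<psi> int_h \<psi>_le)
  also have "\<dots> = measure (rounding I d x) {Z. Z i = Some a \<and> Z j = Some b}"
    unfolding h_def by (rule prob_rounding_pair(1)[OF fin, symmetric])
  finally have "measure (gauss d) E / M\<^sup>2 \<le> measure (rounding I d x) {Z. Z i = Some a \<and> Z j = Some b}" .
  moreover have "1 / (32 * list_const\<^sup>2) * (l / R) * dot d (x i a) (x j b) \<le> measure (gauss d) E / M\<^sup>2"
  proof -
    have "dot d (x i a) (x j b) = n i a * n j b * dot d (e i a) (e j b)"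
      using False by (simp add: e_def dot_unit_left dot_unit_right n_def)
    then have "1 / (32 * list_const\<^sup>2) * (l / R) * dot d (x i a) (x j b)
      = n i a * n j b / (4 * R) * (dot d (e i a) (e j b) * l / 8) / M\<^sup>2"
      by (simp add: M_def mult_ac)
    also have "\<dots> \<le> measure (gauss d) E / M\<^sup>2" by (intro divide_right_mono E_ge) auto
    finally show ?thesis .
  qed
  ultimately show ?thesis by linarith
qed

text \<open>Linearity of expectation over the normalised constraints, which reduces the theorem to
  one pair of labels at a time.\<close>

lemma expected_num_sat_ge:
  assumes fin: "finite (alphabet I)"
  shows "(\<Sum>(i, a, j, b) \<in># normalized I. measure (rounding I d x) {Z. Z i = Some a \<and> Z j = Some b})
    \<le> (\<integral>Z. real (num_sat I Z) \<partial>rounding I d x)"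
proof -
  interpret P: prob_space "rounding I d x" by (rule prob_space_rounding[OF fin])
  have sets: "sets (rounding I d x) = UNIV"
    unfolding rounding_def
    by (subst sets_bind[OF sets_kernel[OF measurable_rounding_kernel[OF fin]]]) (auto simp: gauss.not_empty)
  then have space: "space (rounding I d x) = UNIV" using sets_eq_imp_space_eq[of "rounding I d x" "count_space UNIV"] by simp
  \<comment> \<open>The kernel takes values in measures on a discrete space, so every set, and hence
    every function, is measurable.\<close>
  have meas: "f \<in> borel_measurable (rounding I d x)" for f :: "_ \<Rightarrow> real"
    using sets by (auto simp: measurable_def)
  define S where "S c = (case c of (i, a, j, b) \<Rightarrow> {Z :: nat \<Rightarrow> nat option. Z i = Some a \<and> Z j = Some b})" for c
  have int: "integrable (rounding I d x) (\<lambda>Z. \<Sum>c\<in>#N. indicator (S c) Z :: real)" for N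
    by (induction N) (auto intro!: Bochner_Integration.integrable_add simp: sets integrable_indicator_iff P.emeasure_eq_measure space)
  have sum: "(\<integral>Z. (\<Sum>c\<in>#N. indicator (S c) Z) \<partial>rounding I d x) = (\<Sum>c\<in>#N. measure (rounding I d x) (S c))" for N
  proof (induction N)
    case (add c N)
    have "integrable (rounding I d x) (indicator (S c) :: _ \<Rightarrow> real)"
      by (auto simp: sets integrable_indicator_iff P.emeasure_eq_measure space)
    then show ?case using int add by (simp add: Bochner_Integration.integral_add space)
  qed simp
  have "(\<Sum>(i, a, j, b) \<in># normalized I. measure (rounding I d x) {Z. Z i = Some a \<and> Z j = Some b})
     = (\<Sum>c\<in>#normalized I. measure (rounding I d x) (S c))"
    unfolding S_def by (intro arg_cong[where f=sum_mset] image_mset_cong) auto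
  also have "\<dots> = (\<integral>Z. (\<Sum>c\<in>#normalized I. indicator (S c) Z) \<partial>rounding I d x)"
    by (rule sum[symmetric])
  also have "\<dots> \<le> (\<integral>Z. real (num_sat I Z) \<partial>rounding I d x)"
  proof (rule integral_mono[OF int])
    show "integrable (rounding I d x) (\<lambda>Z. real (num_sat I Z))"
      by (rule P.integrable_const_bound[of _ "real (size (constrs I))", OF _ meas])
         (auto simp: num_sat_def intro!: AE_I2 size_mset_mono)
    fix Z
    have "(\<Sum>c\<in>#normalized I. indicator (S c) Z) = real (size {#(i, a, j, b) \<in># normalized I. Z i = Some a \<and> Z j = Some b#})"
      unfolding size_filter_mset_conv S_def
      by (intro arg_cong[where f=sum_mset] image_mset_cong) (auto split: split_indicator)
    also have "\<dots> \<le> real (num_sat I Z)" using num_sat_ge_normalized[OF fin] by simp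
    finally show "(\<Sum>c\<in>#normalized I. indicator (S c) Z) \<le> real (num_sat I Z)" .
  qed
  finally show ?thesis .
qed

text \<open>The only source of \<open>R0\<close>. All conditions concern ln R alone: the second
  absorbs medium correlations, the third keeps the thresholds above sqrt (ln R) / 2.\<close>

lemma large_alphabet_eventually:
  "eventually (\<lambda>R. ln (real R) \<ge> 16 \<and> (ln (real R))\<^sup>2 * exp (- ln (real R) / 32) \<le> 1 \<and>
     exp (- ln (real R) / 2) * exp 2 * (sqrt (ln (real R)) / 2) < std_normal_density (sqrt (ln (real R)) / 2)) at_top"
proof -
  have "eventually (\<lambda>l::real. l\<^sup>2 * exp (- l / 32) \<le> 1) at_top" by real_asymp
  with eventually_ge_at_top[of "16::real"] threshold_lower_eventually
  have "eventually (\<lambda>l. l \<ge> 16 \<and> l\<^sup>2 * exp (- l / 32) \<le> 1 \<and>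
     exp (- l / 2) * exp 2 * (sqrt l / 2) < std_normal_density (sqrt l / 2)) at_top"
    by eventually_elim auto
  moreover have "filterlim (\<lambda>R::nat. ln (real R)) at_top at_top" by real_asymp
  ultimately show ?thesis by (rule eventually_compose_filterlim)
qed

theorem theorem3:
  "\<exists>c::real. c > 0 \<and> (\<exists>R0::nat. \<forall>R\<ge>R0. \<forall>I d x.
     max_2csp R I \<longrightarrow> sdp_optimal I d x \<longrightarrow>
       (\<integral>Z. real (num_sat I Z) \<partial>rounding I d x) \<ge> c * (ln (real R) / real R) * real (OPT I))"
proof -
  define c where "c = 1 / (32 * list_const\<^sup>2)"
  have "list_const > 0" by (simp add: list_const_def add_pos_pos)
  then have "c > 0" by (simp add: c_def)
  obtain R0 where R0: "\<And>R. R \<ge> R0 \<Longrightarrow> ln (real R) \<ge> 16 \<and> (ln (real R))\<^sup>2 * exp (- ln (real R) / 32) \<le> 1 \<and>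
     exp (- ln (real R) / 2) * exp 2 * (sqrt (ln (real R)) / 2) < std_normal_density (sqrt (ln (real R)) / 2)"
    using large_alphabet_eventually by (auto simp: eventually_at_top_linorder)
  have "c * (ln (real R) / real R) * real (OPT I) \<le> (\<integral>Z. real (num_sat I Z) \<partial>rounding I d x)"
    if R: "R \<ge> R0" and I: "max_2csp R I" and x: "sdp_optimal I d x" for R I d x
  proof -
    have l: "ln (real R) \<ge> 16" using R0[OF R] by blast
    then have "R > 0" by (intro Nat.gr0I) auto
    have feas: "sdp_feasible I d x" using x by (simp add: sdp_optimal_def)
    have fin: "finite (alphabet I)" using I by (simp add: max_2csp_def)
    have "c * (ln (real R) / real R) * real (OPT I) \<le> c * (ln (real R) / real R) * sdp_value I d x"
      using \<open>c > 0\<close> l by (intro mult_left_mono OPT_le_sdp_value[OF I x \<open>R > 0\<close>]) auto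
    also have "\<dots> = (\<Sum>(i, a, j, b) \<in># normalized I. c * (ln (real R) / real R) * dot d (x i a) (x j b))"
      by (simp add: sdp_value_def sum_mset_distrib_left case_prod_beta')
    also have "\<dots> \<le> (\<Sum>(i, a, j, b) \<in># normalized I. measure (rounding I d x) {Z. Z i = Some a \<and> Z j = Some b})"
    proof (rule sum_mset_mono)
      fix q assume "q \<in># normalized I"
      moreover obtain i a j b where q: "q = (i, a, j, b)" by (cases q)
      ultimately have "(i, a, j, b) \<in># normalized I" by simp
      then have "c * (ln (real R) / real R) * dot d (x i a) (x j b)
          \<le> measure (rounding I d x) {Z. Z i = Some a \<and> Z j = Some b}"
        unfolding c_def using R0[OF R] by (intro prob_pair_ge I feas normalized_memD[OF I]) blast+
      then show "(case q of (i, a, j, b) \<Rightarrow> c * (ln (real R) / real R) * dot d (x i a) (x j b))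
        \<le> (case q of (i, a, j, b) \<Rightarrow> measure (rounding I d x) {Z. Z i = Some a \<and> Z j = Some b})"
        by (simp add: q)
    qed
    also have "\<dots> \<le> (\<integral>Z. real (num_sat I Z) \<partial>rounding I d x)"
      by (rule expected_num_sat_ge[OF fin])
    finally show ?thesis .
  qed
  with \<open>c > 0\<close> show ?thesis by blast
qed

end
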